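(* Let $\Gamma$ be a group (under composition) of orientation-preserving $C^2$ diffeomorphisms of the circle $\mathbb{S}^1$. The enlarged projective cocycle $M$ associated to $\Gamma$ (a cocycle over the diagonal action of $\Gamma$ on $(\mathbb{S}^1)^3$) is $\mathrm{SO}(2,\mathbb{R})$-reducible if and only if the action of $\Gamma$ on $\mathbb{S}^1$ is $C^2$ conjugate to an action by rotations, that is, if and only if there exists an orientation-preserving $C^2$ diffeomorphism $\varphi$ of $\mathbb{S}^1$ such that $\varphi\circ f\circ\varphi^{-1}$ is a rotation for every $f\in\Gamma$.
   Context: The circle $\mathbb{S}^1$ is identified with $\mathbb{R}/2\pi\mathbb{Z}$ via $\theta\mapsto e^{i\theta}$. All maps are orientation preserving. A $C^2$ diffeomorphism is a $C^2$ bijection with $C^2$ inverse. $\mathcal{M}$ denotes the group of Möbius transformations of the circle, i.e. the maps $z\mapsto e^{i\kappa}\,\frac{z-\sigma}{1-\bar\sigma z}$ of $\{|z|=1\}$ with $\kappa\in\mathbb{R}$ and $\sigma\in\mathbb{C}$, $|\sigma|<1$; it is identified with $\mathrm{PSL}(2,\mathbb{R})$ as a topological group. The subgroup of rotations $z\mapsto e^{i\kappa}z$ (the case $\sigma=0$) is denoted $\mathrm{SO}(2,\mathbb{R})$. Enlarged projective cocycle: for a circle homeomorphism $f$ and three pairwise distinct points $\theta_1,\theta_2,\theta_3\in\mathbb{S}^1$, $M_{f,(\theta_1,\theta_2,\theta_3)}\in\mathcal{M}$ is the unique Möbius transformation sending $\theta_i$ to $f(\theta_i)$ for $i=1,2,3$.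 When $f$ is a $C^2$ diffeomorphism, the map $(\theta_1,\theta_2,\theta_3)\mapsto M_{f,(\theta_1,\theta_2,\theta_3)}$ extends (uniquely) to a continuous map $(\mathbb{S}^1)^3\to\mathcal{M}$, still denoted $M_{f,\cdot}$. It satisfies the cocycle relation $M_{f,(g(\theta_1),g(\theta_2),g(\theta_3))}\circ M_{g,(\theta_1,\theta_2,\theta_3)}=M_{fg,(\theta_1,\theta_2,\theta_3)}$ over the diagonal action $f\cdot(\theta_1,\theta_2,\theta_3)=(f(\theta_1),f(\theta_2),f(\theta_3))$. The enlarged projective cocycle over $\Gamma$ is $\mathrm{SO}(2,\mathbb{R})$-reducible if there is a continuous map $B:(\mathbb{S}^1)^3\to\mathcal{M}$ such that $B(f\cdot x)\circ M_{f,x}\circ B(x)^{-1}$ is a rotation for every $x\in(\mathbb{S}^1)^3$ and every $f\in\Gamma$. *)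

theory Defs
  imports "HOL-Analysis.Analysis" "HOL-Algebra.Bij"
begin

abbreviation circle :: "complex set" where
  "circle \<equiv> sphere 0 1"

abbreviation circle3 :: "(complex \<times> complex \<times> complex) set" where
  "circle3 \<equiv> circle \<times> circle \<times> circle"

text \<open>
  Maps of the circle are elements of \<^term>\<open>Bij circle\<close>, i.e. bijections of the circle with a
  fixed default value elsewhere, so that equality of such functions is equality of circle maps.
  The group of all of them under composition is \<^term>\<open>BijGroup circle\<close>.
\<close>

text \<open>
  Under the identification of the circle with \<open>\<real>/2\<pi>\<int>\<close>, regularity and orientation of a circle
  map are those of its lifts to the real line. Any two continuous lifts differ by a constant, so
  the lifts in the definitions below need not be related.
\<close>

definition lifts :: "(real \<Rightarrow> real) \<Rightarrow> (complex \<Rightarrow> complex) \<Rightarrow> bool" where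
  "lifts F f \<longleftrightarrow> (\<forall>t. f (cis t) = cis (F t))"

definition C2_real :: "(real \<Rightarrow> real) \<Rightarrow> bool" where
  "C2_real F \<longleftrightarrow> (\<exists>F' F''. (\<forall>t. (F has_real_derivative F' t) (at t)) \<and>
     (\<forall>t. (F' has_real_derivative F'' t) (at t)) \<and> continuous_on UNIV F'')"

definition C2_circle_map :: "(complex \<Rightarrow> complex) \<Rightarrow> bool" where
  "C2_circle_map f \<longleftrightarrow> (\<exists>F. C2_real F \<and> lifts F f)"

definition orientation_preserving :: "(complex \<Rightarrow> complex) \<Rightarrow> bool" where
  "orientation_preserving f \<longleftrightarrow> (\<exists>F. continuous_on UNIV F \<and> strict_mono F \<and> lifts F f)"

definition C2_diffeos :: "(complex \<Rightarrow> complex) set" where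
  "C2_diffeos = {f \<in> Bij circle. orientation_preserving f \<and>
     C2_circle_map f \<and> C2_circle_map (inv_into circle f)}"

text \<open>The parameter \<open>u\<close> of modulus one stands for \<open>e\<^sup>i\<^sup>\<kappa>\<close>.\<close>

definition moebius :: "complex \<times> complex \<Rightarrow> complex \<Rightarrow> complex" where
  "moebius = (\<lambda>(u, \<sigma>). \<lambda>z\<in>circle. u * ((z - \<sigma>) / (1 - cnj \<sigma> * z)))"

definition Moebius :: "(complex \<Rightarrow> complex) set" where
  "Moebius = moebius ` (circle \<times> ball 0 1)"

definition Rotations :: "(complex \<Rightarrow> complex) set" where
  "Rotations = {moebius (u, 0) | u. u \<in> circle}"

lemma inj_on_moebius: "inj_on moebius (circle \<times> ball 0 1)"
proof (rule inj_onI, clarify)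
  fix u s v t :: complex
  assume u: "u \<in> circle" and s: "s \<in> ball 0 1" and v: "v \<in> circle" and t: "t \<in> ball 0 1"
    and eq: "moebius (u, s) = moebius (v, t)"
  have nz: "1 - cnj a * z \<noteq> 0" if "a \<in> ball 0 1" "z \<in> circle" for a z
  proof
    assume "1 - cnj a * z = 0"
    then have "norm (cnj a * z) = 1" by (metis eq_iff_diff_eq_0 norm_one)
    then show False using that by (simp add: norm_mult)
  qed
  have E: "u * (z - s) * (1 - cnj t * z) = v * (z - t) * (1 - cnj s * z)" if "z \<in> circle" for z
    using fun_cong[OF eq, of z] nz[OF s that] nz[OF t that] that
    by (simp add: moebius_def divide_simps mult_ac)
  have lin: "u * (1 + s * cnj t) = v * (1 + t * cnj s)"
    using E[of 1] E[of "-1"] by (simp add: algebra_simps) algebra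
  have con: "u * s = v * t"
    using E[of 1] E[of "-1"] E[of \<i>] by (simp add: algebra_simps) algebra
  have nst: "norm s = norm t"
    using arg_cong[OF con, of norm] u v by (simp add: norm_mult)
  then have "s * cnj s = t * cnj t" by (simp add: complex_norm_square[symmetric])
  with con lin have "(u - v) * (1 - s * cnj s) = 0" by algebra
  moreover have "1 - s * cnj s \<noteq> 0"
  proof
    assume "1 - s * cnj s = 0"
    then have "norm (s * cnj s) = 1" by (metis eq_iff_diff_eq_0 norm_one)
    moreover have "norm s * norm s < 1" using s mult_strict_mono[of "norm s" 1 "norm s" 1] by simp
    ultimately show False by (simp add: norm_mult)
  qed
  ultimately have "u = v" by simp
  then show "u = v \<and> s = t" using con u by auto
qed

text \<open>
  The topology of \<open>PSL(2,\<real>)\<close>: the pair \<open>(u, \<sigma>)\<close> is a global coordinate system, identifying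
  the group homeomorphically with the product of the circle and the open unit disc.
\<close>

definition moebius_topology :: "(complex \<Rightarrow> complex) topology" where
  "moebius_topology =
     pullback_topology Moebius (the_inv_into (circle \<times> ball 0 1) moebius) euclidean"

definition distinct3 :: "(complex \<times> complex \<times> complex) set" where
  "distinct3 = {(a, b, c) \<in> circle3. a \<noteq> b \<and> a \<noteq> c \<and> b \<noteq> c}"

definition projective_cocycle ::
  "(complex \<Rightarrow> complex) \<Rightarrow> complex \<times> complex \<times> complex \<Rightarrow> complex \<Rightarrow> complex" where
  "projective_cocycle f = (\<lambda>(a, b, c).
     THE m. m \<in> Moebius \<and> m a = f a \<and> m b = f b \<and> m c = f c)"

text \<open>
  The continuous extension to all triples. It exists and is unique for \<^term>\<open>f \<in> C2_diffeos\<close>;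
  it is only meant to be used for such \<open>f\<close>.
\<close>

definition enlarged_cocycle ::
  "(complex \<Rightarrow> complex) \<Rightarrow> complex \<times> complex \<times> complex \<Rightarrow> complex \<Rightarrow> complex" where
  "enlarged_cocycle f = (THE \<Phi>. \<Phi> \<in> extensional circle3 \<and>
     continuous_map (top_of_set circle3) moebius_topology \<Phi> \<and>
     (\<forall>x\<in>distinct3. \<Phi> x = projective_cocycle f x))"

definition diagonal_action ::
  "(complex \<Rightarrow> complex) \<Rightarrow> complex \<times> complex \<times> complex \<Rightarrow> complex \<times> complex \<times> complex" where
  "diagonal_action f = (\<lambda>(a, b, c). (f a, f b, f c))"

definition SO2_reducible :: "(complex \<Rightarrow> complex) set \<Rightarrow> bool" where
  "SO2_reducible \<Gamma> \<longleftrightarrow>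
     (\<exists>B. continuous_map (top_of_set circle3) moebius_topology B \<and>
       (\<forall>x\<in>circle3. \<forall>f\<in>\<Gamma>.
          B (diagonal_action f x) \<otimes>\<^bsub>BijGroup circle\<^esub> enlarged_cocycle f x
            \<otimes>\<^bsub>BijGroup circle\<^esub> inv\<^bsub>BijGroup circle\<^esub> B x \<in> Rotations))"

end

theory Submission
  imports Defs "HOL-Library.Periodic_Fun"
begin

text \<open>
  The Moebius map through \<open>(a, f a)\<close>, \<open>(b, f b)\<close>, \<open>(c, f c)\<close> is expressed by the divided
  differences of \<open>f\<close> in the complex variable: the slopes \<open>g(z, w) = (f z - f w) / (z - w)\<close> and the
  second difference \<open>k = (g(a, c) - g(b, c)) / (a - b)\<close>. With \<open>e = g(a, c) + b k\<close> the parameter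
  \<open>\<sigma>\<close> of the map is the conjugate of \<open>k / e\<close>. If \<open>f\<close> is \<open>C\<^sup>2\<close>, then \<open>g\<close> and \<open>k\<close> extend continuously
  to coinciding points, and \<open>\<bar>e\<bar>\<^sup>2 - \<bar>k\<bar>\<^sup>2 = \<bar>g(a, b) g(a, c) g(b, c)\<bar> > 0\<close>, an identity that uses that
  \<open>f\<close> preserves the orientation, keeps \<open>\<sigma>\<close> inside the disc. This gives the enlarged cocycle in
  coordinates, lemma \<open>enlarged_cocycle_moebius\<close>. On the total diagonal it is the 2-jet of \<open>f\<close>: with
  \<open>q\<close> the quotient \<open>cnj \<sigma> z / (1 - cnj \<sigma> z)\<close> and \<open>F\<close> a lift of \<open>f\<close>, one gets
  \<open>2 F' q = F'\<^sup>2 - F' - \<i> F''\<close>.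

  Suppose that \<open>\<phi>\<close> conjugates \<open>\<Gamma>\<close> to rotations, \<open>\<phi> \<circ> f = R \<circ> \<phi>\<close>. Then \<open>B = M\<^sub>\<phi>\<close> reduces the
  cocycle: \<open>B(f x) \<circ> M\<^sub>f\<^sub>,\<^sub>x = R \<circ> B(x)\<close> holds for triples of distinct points, since a Moebius map is
  determined by three values, and for all triples by density.

  Conversely, let \<open>B\<close> reduce the cocycle and write \<open>c(t)\<close> for the number \<open>q\<close> of \<open>B\<close> at the triple
  \<open>(z, z, z)\<close>, \<open>z = cis t\<close>. Put \<open>\<rho> = 1 + 2 Re c\<close> and \<open>N = - 2 Im c\<close>. The chain rule for 2-jets,
  lemma \<open>moebius_jet_compose\<close>, turns reducibility on the diagonal into
  \<open>\<rho> = F' (\<rho> \<circ> F)\<close> and \<open>N = F'' / F' + F' (N \<circ> F)\<close>. The first equation says that \<open>\<rho> dt\<close> is an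
  invariant measure, but \<open>\<rho>\<close> is only continuous and integrating it would only give a \<open>C\<^sup>1\<close>
  conjugacy. The second equation, which the logarithmic derivative of a \<open>C\<^sup>1\<close> invariant density
  satisfies, allows to replace \<open>\<rho>\<close> by a better density: let \<open>h\<close> be an
  antiderivative of \<open>N - c\<^sub>0 \<rho>\<close>, where the constant \<open>c\<^sub>0\<close> makes \<open>h\<close> periodic. Then
  \<open>h \<circ> F + ln F' - h\<close> has derivative zero, and its constant value is zero because both \<open>e\<^sup>h dt\<close> and
  its pullback have the same total mass. So \<open>e\<^sup>h dt\<close> is an invariant measure with \<open>C\<^sup>1\<close> density, and
  its distribution function, suitably normalised, is the lift of the required \<open>C\<^sup>2\<close> diffeomorphism
  (lemma \<open>conjugating_lift_of_affine_cocycle\<close>).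
\<close>

section \<open>Moebius transformations of the circle\<close>

lemma circle_iff: "z \<in> circle \<longleftrightarrow> norm z = 1"
  by simp

lemma circle_cnj: "z \<in> circle \<Longrightarrow> z * cnj z = 1"
  by (simp add: complex_norm_square[symmetric])

lemma circle_nonzero: "z \<in> circle \<Longrightarrow> z \<noteq> 0"
  by auto

lemma circle_cis_Arg: "z \<in> circle \<Longrightarrow> cis (Arg z) = z"
  using cis_Arg[OF circle_nonzero[of z]] by (simp add: sgn_div_norm)

lemma one_minus_cnj_mult_nonzero:
  assumes "norm s < 1" "norm z \<le> 1" shows "1 - cnj s * z \<noteq> 0"
proof
  assume "1 - cnj s * z = 0"
  then have "norm (cnj s * z) = 1" by (metis eq_iff_diff_eq_0 norm_one)
  moreover have "norm (cnj s * z) \<le> norm s"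
    using assms mult_left_mono[of "norm z" 1 "norm s"] by (simp add: norm_mult)
  ultimately show False using assms by simp
qed

lemma moebius_apply: "z \<in> circle \<Longrightarrow> moebius (u, s) z = u * ((z - s) / (1 - cnj s * z))"
  by (simp add: moebius_def)

lemma moebius_in_circle:
  assumes "u \<in> circle" "norm s < 1" "z \<in> circle"
  shows "moebius (u, s) z \<in> circle"
proof -
  have "z - s = z * cnj (1 - cnj s * z)"
    using circle_cnj[OF assms(3)] by (simp add: algebra_simps)
  then have "norm (z - s) = norm (1 - cnj s * z)"
    using assms(3) by (metis circle_iff complex_mod_cnj mult_1 norm_mult)
  then show ?thesis
    using assms one_minus_cnj_mult_nonzero[of s z]
    by (simp add: moebius_apply norm_mult norm_divide)
qed

text \<open>
  The factor \<open>d\<close> is what is left of the denominators when the composite is brought into normal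
  form; \<open>\<bar>d\<bar>\<^sup>2 - \<bar>cnj s + cnj t u\<bar>\<^sup>2 = (1 - \<bar>s\<bar>\<^sup>2) (1 - \<bar>t\<bar>\<^sup>2)\<close> keeps the new centre in the disc.
\<close>

lemma moebius_compose:
  assumes u: "u \<in> circle" "norm s < 1" and v: "v \<in> circle" "norm t < 1"
  defines "d \<equiv> 1 + cnj t * u * s"
  defines "r \<equiv> cnj ((cnj s + cnj t * u) / d)" and "w \<equiv> v * u * cnj d / d"
  shows "w \<in> circle" "norm r < 1" "d \<noteq> 0"
    and "\<And>z. z \<in> circle \<Longrightarrow> moebius (v, t) (moebius (u, s) z) = moebius (w, r) z"
proof -
  have "norm (- (u * s)) < 1" using u by (simp add: norm_mult)
  then have d0: "d \<noteq> 0"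
    using one_minus_cnj_mult_nonzero[of t "- (u * s)"] v by (simp add: d_def mult.assoc)
  then show "d \<noteq> 0" .
  show "w \<in> circle" using u v d0 by (simp add: w_def norm_mult norm_divide)
  have uu: "u * cnj u = 1" using circle_cnj u by blast
  have "d * cnj d - (cnj s + cnj t * u) * cnj (cnj s + cnj t * u)
      = (1 - s * cnj s) * (1 - t * cnj t)"
    using uu unfolding d_def by simp algebra
  then have "complex_of_real ((norm d)\<^sup>2 - (norm (cnj s + cnj t * u))\<^sup>2)
      = complex_of_real ((1 - (norm s)\<^sup>2) * (1 - (norm t)\<^sup>2))"
    by (simp only: of_real_diff of_real_mult of_real_1 complex_norm_square)
  then have "(norm d)\<^sup>2 - (norm (cnj s + cnj t * u))\<^sup>2 = (1 - (norm s)\<^sup>2) * (1 - (norm t)\<^sup>2)"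
    by (simp only: of_real_eq_iff)
  moreover have "(1 - (norm s)\<^sup>2) * (1 - (norm t)\<^sup>2) > 0"
    using u v by (simp add: power_less_one_iff)
  ultimately have "(norm (cnj s + cnj t * u))\<^sup>2 < (norm d)\<^sup>2" by simp
  then have "norm (cnj s + cnj t * u) < norm d" by (simp add: power_less_imp_less_base)
  then show r1: "norm r < 1" using d0 unfolding r_def complex_mod_cnj by (simp add: norm_divide)
  fix z assume z: "z \<in> circle"
  define D where "D = 1 - cnj s * z"
  have D: "D \<noteq> 0" using one_minus_cnj_mult_nonzero[of s z] u z by (simp add: D_def)
  define m where "m = moebius (u, s) z"
  have mD: "m * D = u * (z - s)" using D z by (simp add: m_def moebius_apply D_def)
  have mc: "m \<in> circle" using moebius_in_circle u z m_def by simp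
  have n2: "1 - cnj t * m \<noteq> 0" using one_minus_cnj_mult_nonzero[of t m] v mc by simp
  have n3: "1 - cnj r * z \<noteq> 0" using one_minus_cnj_mult_nonzero[of r z] r1 z by simp
  have e1: "(1 - cnj t * m) * D = d * (1 - cnj r * z)"
  proof -
    have "d * cnj r = cnj s + cnj t * u" using d0 by (simp add: r_def)
    then show ?thesis using mD unfolding d_def D_def by algebra
  qed
  have e2: "v * (m - t) * D * d = w * d * (z - r) * d"
  proof -
    have "cnj d * r = s + t * cnj u" using d0 by (simp add: r_def)
    moreover have "w * d = v * u * cnj d" using d0 by (simp add: w_def)
    moreover have "cnj d = 1 + t * cnj u * cnj s" by (simp add: d_def)
    ultimately have "w * d * (z - r) = v * (u * (z - s) - t * D)"
      using uu unfolding D_def by algebra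
    then show ?thesis using mD by algebra
  qed
  have "v * (m - t) * (1 - cnj r * z) = w * (z - r) * (1 - cnj t * m)"
  proof -
    have "v * (m - t) * (1 - cnj r * z) * (D * d) = w * (z - r) * (1 - cnj t * m) * (D * d)"
      using e1 e2 by algebra
    then show ?thesis using D d0 by simp
  qed
  then have "v * ((m - t) / (1 - cnj t * m)) = w * ((z - r) / (1 - cnj r * z))"
    using n2 n3 by (simp add: field_simps)
  then show "moebius (v, t) (moebius (u, s) z) = moebius (w, r) z"
    using mc z unfolding m_def by (simp add: moebius_apply)
qed

text \<open>
  The 2-jet of a Moebius map, modulo rotations, as one complex number: a lift \<open>L\<close> of
  \<open>moebius (u, s)\<close> satisfies \<open>L' = 1 + 2 Re q\<close> and \<open>L'' / L' = - 2 Im q\<close> at \<open>z = cis t\<close>, where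
  \<open>q = moebius_jet s z\<close>.
\<close>

definition moebius_jet :: "complex \<Rightarrow> complex \<Rightarrow> complex" where
  "moebius_jet s z = cnj s * z / (1 - cnj s * z)"

text \<open>
  On the circle \<open>(1 - cnj s z) (z - s) = z \<bar>1 - cnj s z\<bar>\<^sup>2\<close>, so \<open>1 + 2 Re q\<close> is the Poisson kernel
  \<open>(1 - \<bar>s\<bar>\<^sup>2) / \<bar>1 - cnj s z\<bar>\<^sup>2\<close>.
\<close>

lemma one_plus_Re_moebius_jet:
  assumes "norm s < 1" "z \<in> circle"
  shows "complex_of_real (1 + 2 * Re (moebius_jet s z)) * ((1 - cnj s * z) * (z - s))
      = z * (1 - s * cnj s)"
proof -
  define D where "D = 1 - cnj s * z"
  have D: "D \<noteq> 0" using one_minus_cnj_mult_nonzero[of s z] assms by (simp add: D_def)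
  have zz: "z * cnj z = 1" using circle_cnj assms by blast
  have q: "moebius_jet s z * D = cnj s * z" using D by (simp add: moebius_jet_def D_def)
  have cq: "cnj (moebius_jet s z) * cnj D = s * cnj z" using arg_cong[OF q, of cnj] by simp
  have "z - s = z * cnj D" using zz by (simp add: D_def algebra_simps)
  moreover have "complex_of_real (1 + 2 * Re (moebius_jet s z))
      = 1 + moebius_jet s z + cnj (moebius_jet s z)"
    using complex_add_cnj[of "moebius_jet s z"] by (simp add: add.assoc)
  ultimately have "complex_of_real (1 + 2 * Re (moebius_jet s z)) * (D * (z - s))
      = z * (D * cnj D + (moebius_jet s z * D) * cnj D + (cnj (moebius_jet s z) * cnj D) * D)"
    by algebra
  also have "\<dots> = z * (1 - s * cnj s)"
    unfolding q cq using zz by (simp add: D_def) algebra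
  finally show ?thesis by (simp add: D_def)
qed

lemma one_plus_Re_moebius_jet_pos:
  assumes "norm s < 1" "z \<in> circle"
  shows "0 < 1 + 2 * Re (moebius_jet s z)"
proof -
  define D where "D = 1 - cnj s * z"
  have D: "D \<noteq> 0" using one_minus_cnj_mult_nonzero[of s z] assms by (simp add: D_def)
  have zz: "z * cnj z = 1" using circle_cnj assms by blast
  have "z - s = z * cnj D" using zz by (simp add: D_def algebra_simps)
  then have "z * (complex_of_real (1 + 2 * Re (moebius_jet s z)) * (D * cnj D)) = z * (1 - s * cnj s)"
    using one_plus_Re_moebius_jet[OF assms] by (simp add: D_def mult_ac)
  then have "complex_of_real (1 + 2 * Re (moebius_jet s z)) * (D * cnj D) = 1 - s * cnj s"
    using assms(2) mult_left_cancel[OF circle_nonzero[OF assms(2)]] by blast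
  then have "complex_of_real ((1 + 2 * Re (moebius_jet s z)) * (norm D)\<^sup>2) = complex_of_real (1 - (norm s)\<^sup>2)"
    by (simp only: of_real_diff of_real_mult of_real_1 complex_norm_square)
  then have "(1 + 2 * Re (moebius_jet s z)) * (norm D)\<^sup>2 = 1 - (norm s)\<^sup>2"
    by (simp only: of_real_eq_iff)
  moreover have "1 - (norm s)\<^sup>2 > 0" using assms by (simp add: power_less_one_iff)
  ultimately show ?thesis
    by (metis zero_less_mult_pos2 D zero_less_norm_iff zero_less_power)
qed

text \<open>
  The chain rule for 2-jets. Its real part is the chain rule for first derivatives of lifts, its
  imaginary part the one for \<open>L'' / L'\<close>.
\<close>

lemma moebius_jet_compose:
  assumes u: "u \<in> circle" "norm s < 1" and v: "v \<in> circle" "norm t < 1"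
    and w: "w \<in> circle" "norm r < 1"
    and comp: "\<And>z. z \<in> circle \<Longrightarrow> moebius (v, t) (moebius (u, s) z) = moebius (w, r) z"
    and z: "z \<in> circle"
  shows "moebius_jet r z = moebius_jet s z
      + of_real (1 + 2 * Re (moebius_jet s z)) * moebius_jet t (moebius (u, s) z)"
proof -
  define d where "d = 1 + cnj t * u * s"
  define r' where "r' = cnj ((cnj s + cnj t * u) / d)"
  define w' where "w' = v * u * cnj d / d"
  note M = moebius_compose[OF u v, folded d_def, folded r'_def w'_def]
  have "moebius (w', r') = moebius (w, r)"
  proof
    fix z show "moebius (w', r') z = moebius (w, r) z"
      using M(4) comp by (cases "z \<in> circle") (auto simp: moebius_def)
  qed
  then have "(w', r') = (w, r)" using inj_onD[OF inj_on_moebius] M w by auto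
  then have r: "cnj r * d = cnj s + cnj t * u" using M(3) by (auto simp: r'_def)
  define D where "D = 1 - cnj s * z"
  have D: "D \<noteq> 0" using one_minus_cnj_mult_nonzero[of s z] u z by (simp add: D_def)
  define m where "m = moebius (u, s) z"
  have mD: "m * D = u * (z - s)" using D z by (simp add: m_def moebius_apply D_def)
  have mc: "m \<in> circle" using moebius_in_circle u z m_def by simp
  have n2: "1 - cnj t * m \<noteq> 0" using one_minus_cnj_mult_nonzero[of t m] v mc by simp
  have n3: "1 - cnj r * z \<noteq> 0" using one_minus_cnj_mult_nonzero[of r z] w z by simp
  have e1: "d * (1 - cnj r * z) = (1 - cnj t * m) * D"
    using mD r unfolding d_def D_def by algebra
  define P where "P = complex_of_real (1 + 2 * Re (moebius_jet s z))"
  have z0: "z \<noteq> 0" using z by auto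
  have P: "P * (D * (z - s)) = z * (1 - s * cnj s)"
    using one_plus_Re_moebius_jet[OF u(2) z] by (simp add: P_def D_def)
  \<comment> \<open>With \<open>P\<close> the derivative of a lift this is \<open>z m'(z) = P m(z)\<close>, because \<open>D m'(z) = u + cnj s m(z)\<close>.\<close>
  have "u * (z * (u + cnj s * m) - P * m * D) * D = 0"
    using P mD unfolding D_def by algebra
  then have Pm: "z * (u + cnj s * m) = P * m * D"
    using D u by auto
  have q1: "moebius_jet r z * ((1 - cnj t * m) * D) = (cnj s + cnj t * u) * z"
  proof -
    have "moebius_jet r z * (1 - cnj r * z) = cnj r * z" using n3 by (simp add: moebius_jet_def)
    then show ?thesis using e1 r by algebra
  qed
  have q2: "moebius_jet s z * D = cnj s * z" using D by (simp add: moebius_jet_def D_def)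
  have q3: "moebius_jet t m * (1 - cnj t * m) = cnj t * m" using n2 by (simp add: moebius_jet_def)
  have "moebius_jet r z * ((1 - cnj t * m) * D)
      = (moebius_jet s z + P * moebius_jet t m) * ((1 - cnj t * m) * D)"
    using q1 q2 q3 Pm unfolding D_def by algebra
  then show ?thesis using n2 D by (simp add: P_def m_def)
qed

text \<open>
  Agreement at \<open>z\<close> is a polynomial equation of degree at most two in \<open>z\<close>, so three solutions force
  its coefficients to vanish.
\<close>

lemma moebius_eq_of_three_points:
  assumes u: "norm s < 1" "norm t < 1"
    and x: "(a, b, c) \<in> distinct3"
    and eq: "\<And>z. z \<in> {a, b, c} \<Longrightarrow> moebius (u, s) z = moebius (v, t) z"
  shows "moebius (u, s) = moebius (v, t)"
proof
  fix z
  have abc: "a \<in> circle" "b \<in> circle" "c \<in> circle" "a \<noteq> b" "a \<noteq> c" "b \<noteq> c"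
    using x by (auto simp: distinct3_def)
  have iff: "moebius (u, s) z = moebius (v, t) z
      \<longleftrightarrow> u * (z - s) * (1 - cnj t * z) = v * (z - t) * (1 - cnj s * z)" if "z \<in> circle" for z
    using one_minus_cnj_mult_nonzero[of s z] one_minus_cnj_mult_nonzero[of t z] that u
    by (simp add: moebius_apply field_simps)
  have "u * (z - s) * (1 - cnj t * z) = v * (z - t) * (1 - cnj s * z)" if "z \<in> {a, b, c}" for z
    using iff eq that abc by blast
  then have E: "u * (z - s) * (1 - cnj t * z) - v * (z - t) * (1 - cnj s * z) = 0"
    if "z \<in> {a, b, c}" for z using that by simp
  define A where "A = v * cnj s - u * cnj t"
  define B where "B = u * (1 + s * cnj t) - v * (1 + t * cnj s)"
  define C where "C = v * t - u * s"
  have Q: "u * (z - s) * (1 - cnj t * z) - v * (z - t) * (1 - cnj s * z) = A * z^2 + B * z + C" for z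
    unfolding A_def B_def C_def by algebra
  have Qa: "A * a^2 + B * a + C = 0" and Qb: "A * b^2 + B * b + C = 0" and Qc: "A * c^2 + B * c + C = 0"
    using E Q by auto
  have "(a - b) * (A * (a + b) + B) = 0" using Qa Qb by algebra
  then have ab: "A * (a + b) + B = 0" using abc by simp
  have "(a - c) * (A * (a + c) + B) = 0" using Qa Qc by algebra
  then have ac: "A * (a + c) + B = 0" using abc by simp
  have "A * (b - c) = 0" using ab ac by algebra
  then have "A = 0" using abc by simp
  with ab Qa have "B = 0" "C = 0" by auto
  with Q \<open>A = 0\<close> iff show "moebius (u, s) z = moebius (v, t) z"
    by (cases "z \<in> circle") (auto simp: moebius_def)
qed

lemma moebius_Bij:
  assumes "u \<in> circle" "norm s < 1"
  shows "moebius (u, s) \<in> Bij circle"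
proof -
  have left_inverse: "moebius (cnj u, - (u * s)) (moebius (u, s) z) = z"
    if u: "u \<in> circle" "norm s < 1" and z: "z \<in> circle" for u s z
  proof -
    have v: "cnj u \<in> circle" "norm (- (u * s)) < 1" using u by (auto simp: norm_mult)
    have uu: "u * cnj u = 1" using circle_cnj u by blast
    define d where "d = 1 + cnj (- (u * s)) * u * s"
    have d: "d \<noteq> 0" using moebius_compose(3)[OF u v] d_def by simp
    have e: "cnj s + cnj (- (u * s)) * u = 0" using uu by simp algebra
    have cd: "cnj d = d" unfolding d_def using uu by simp
    have "cnj u * u * cnj d / d = 1" using d uu by (simp add: cd mult.commute)
    then have "moebius (cnj u, - (u * s)) (moebius (u, s) z) = moebius (1, 0) z"
      using moebius_compose(4)[OF u v z, folded d_def] by (simp only: e) simp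
    then show ?thesis using z by (simp add: moebius_apply)
  qed
  have v: "cnj u \<in> circle" "norm (- (u * s)) < 1" using assms by (auto simp: norm_mult)
  have "cnj u * u * s = s" using circle_cnj[OF assms(1)] by (simp add: mult.commute)
  then have vv: "cnj (cnj u) = u" "- (cnj u * - (u * s)) = s" by (auto simp: mult.assoc)
  have "bij_betw (moebius (u, s)) circle circle"
    \<comment> \<open>The inverse of \<open>z \<mapsto> u (z - s) / (1 - cnj s z)\<close>.\<close>
    by (rule bij_betw_byWitness[where f' = "moebius (cnj u, - (u * s))"])
      (use left_inverse[OF assms] left_inverse[OF v, unfolded vv] moebius_in_circle[OF assms]
        moebius_in_circle[OF v] in \<open>auto simp del: mem_sphere_0\<close>)
  then show ?thesis by (auto simp: Bij_def moebius_def extensional_def)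
qed

text \<open>
  Both sides of the main equivalence are statements about products of this form in the group of
  bijections; pointwise equations are what the analysis provides.
\<close>

lemma conjugate_in_Rotations_iff:
  assumes "a \<in> Bij circle" "b \<in> Bij circle" "c \<in> Bij circle"
  shows "a \<otimes>\<^bsub>BijGroup circle\<^esub> b \<otimes>\<^bsub>BijGroup circle\<^esub> inv\<^bsub>BijGroup circle\<^esub> c \<in> Rotations
      \<longleftrightarrow> (\<exists>v\<in>circle. \<forall>z\<in>circle. a (b z) = v * c z)"
proof -
  interpret group "BijGroup circle" by (rule group_BijGroup)
  have car: "carrier (BijGroup circle) = Bij circle" by (simp add: BijGroup_def)
  have mult: "g \<otimes>\<^bsub>BijGroup circle\<^esub> h = compose circle g h"
    if "g \<in> Bij circle" "h \<in> Bij circle" for g h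
    using that by (simp add: BijGroup_def)
  have rot: "moebius (v, 0) \<in> Bij circle" if "v \<in> circle" for v
    using moebius_Bij[of v 0] that by simp
  have "a \<otimes>\<^bsub>BijGroup circle\<^esub> b \<otimes>\<^bsub>BijGroup circle\<^esub> inv\<^bsub>BijGroup circle\<^esub> c = moebius (v, 0)
      \<longleftrightarrow> (\<forall>z\<in>circle. a (b z) = v * c z)" if v: "v \<in> circle" for v
  proof -
    have "a \<otimes>\<^bsub>BijGroup circle\<^esub> b \<otimes>\<^bsub>BijGroup circle\<^esub> inv\<^bsub>BijGroup circle\<^esub> c = moebius (v, 0)
      \<longleftrightarrow> a \<otimes>\<^bsub>BijGroup circle\<^esub> b = moebius (v, 0) \<otimes>\<^bsub>BijGroup circle\<^esub> c"
      using assms rot[OF v] car by (metis inv_closed inv_solve_right m_closed)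
    also have "\<dots> \<longleftrightarrow> compose circle a b = compose circle (moebius (v, 0)) c"
      using mult assms rot[OF v] by simp
    also have "\<dots> \<longleftrightarrow> (\<forall>z\<in>circle. a (b z) = moebius (v, 0) (c z))"
      by (auto simp: compose_def restrict_def fun_eq_iff)
    also have "\<dots> \<longleftrightarrow> (\<forall>z\<in>circle. a (b z) = v * c z)"
      using Bij_imp_funcset[OF assms(3)] by (intro ball_cong refl) (auto simp: moebius_apply Pi_iff)
    finally show ?thesis .
  qed
  then show ?thesis unfolding Rotations_def by blast
qed

section \<open>Divided differences along the circle\<close>

text \<open>
  By Hadamard's lemma the mean of \<open>\<Phi>'\<close> between \<open>t\<close> and \<open>s\<close> is the divided difference of \<open>\<Phi>\<close>, in a
  form that also makes sense, and depends continuously on the points, when \<open>s = t\<close>.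
\<close>

definition mean_along :: "(real \<Rightarrow> complex) \<Rightarrow> real \<Rightarrow> real \<Rightarrow> complex" where
  "mean_along D s t = integral {0..1} (\<lambda>x. D (t + x * (s - t)))"

lemma mean_along_diag [simp]: "mean_along D t t = D t"
  by (simp add: mean_along_def)

lemma mean_along_mult:
  assumes I: "convex I" "s \<in> I" "t \<in> I"
    and \<Phi>: "\<And>x. x \<in> I \<Longrightarrow> (\<Phi> has_vector_derivative D x) (at x)"
  shows "mean_along D s t * of_real (s - t) = \<Phi> s - \<Phi> t"
proof -
  have inI: "t + x * (s - t) \<in> I" if "x \<in> {0..1}" for x
    using convexD_alt[OF I(1) I(3) I(2), of x] that by (simp add: algebra_simps)
  have "((\<lambda>x. \<Phi> (t + x * (s - t))) has_vector_derivative (s - t) *\<^sub>R D (t + x * (s - t)))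
      (at x within {0..1})" if "x \<in> {0..1}" for x
  proof -
    have "((\<lambda>x. t + x * (s - t)) has_vector_derivative (s - t)) (at x)"
      by (auto intro!: derivative_eq_intros)
    from vector_diff_chain_at[OF this \<Phi>[OF inI[OF that]]]
    show ?thesis by (simp add: o_def has_vector_derivative_at_within)
  qed
  then have "((\<lambda>x. (s - t) *\<^sub>R D (t + x * (s - t))) has_integral (\<Phi> s - \<Phi> t)) {0..1}"
    using fundamental_theorem_of_calculus[of 0 1 "\<lambda>x. \<Phi> (t + x * (s - t))"] by simp
  then have "integral {0..1} (\<lambda>x. (s - t) *\<^sub>R D (t + x * (s - t))) = \<Phi> s - \<Phi> t"
    by (rule integral_unique)
  then show ?thesis
    by (simp add: mean_along_def scaleR_conv_of_real mult.commute)
qed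

text \<open>
  The weight covers both means (weight 1) and their derivatives in \<open>s\<close> (weight \<open>x\<close>). The parameter
  \<open>p\<close> is the third point when the mean of a derivative of slopes is taken.
\<close>

lemma continuous_on_weighted_mean_along:
  fixes D :: "real \<Rightarrow> 'p::topological_space \<Rightarrow> complex"
  assumes I: "convex I" and D: "continuous_on (I \<times> P) (\<lambda>(s, p). D s p)"
    and c: "continuous_on UNIV c"
  shows "continuous_on (I \<times> I \<times> P)
    (\<lambda>(s, t, p). integral {0..1} (\<lambda>x. c x *\<^sub>R D (t + x * (s - t)) p))"
proof -
  have "continuous_on ((I \<times> I \<times> P) \<times> cbox 0 (1::real))
      (\<lambda>y. (\<lambda>(s, p). D s p) (fst (snd (fst y)) + snd y * (fst (fst y) - fst (snd (fst y))), snd (snd (fst y))))"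
  proof (rule continuous_on_compose2[OF D])
    show "(\<lambda>y. (fst (snd (fst y)) + snd y * (fst (fst y) - fst (snd (fst y))), snd (snd (fst y))))
        ` ((I \<times> I \<times> P) \<times> cbox 0 1) \<subseteq> I \<times> P"
      using convexD_alt[OF I] by (auto simp: algebra_simps)
  qed (intro continuous_intros)
  then have "continuous_on ((I \<times> I \<times> P) \<times> cbox 0 (1::real))
      (\<lambda>(y, x). (\<lambda>(s, t, p). c x *\<^sub>R D (t + x * (s - t)) p) y)"
    by (auto simp: case_prod_unfold intro!: continuous_intros continuous_on_compose2[OF c])
  from integral_continuous_on_param[OF this]
  show ?thesis by (simp add: case_prod_unfold)
qed

lemma continuous_on_mean_along:
  fixes D :: "real \<Rightarrow> 'p::topological_space \<Rightarrow> complex"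
  assumes "convex I" and "continuous_on (I \<times> P) (\<lambda>(s, p). D s p)"
  shows "continuous_on (I \<times> I \<times> P) (\<lambda>(s, t, p). mean_along (\<lambda>s. D s p) s t)"
  using continuous_on_weighted_mean_along[OF assms, of "\<lambda>_. 1"] by (simp add: mean_along_def)

text \<open>
  With \<open>D'\<close> the derivative of \<open>D\<close>, this is the partial derivative of \<open>mean_along D s t\<close> in \<open>s\<close>.
\<close>

definition mean_along_slope :: "(real \<Rightarrow> complex) \<Rightarrow> real \<Rightarrow> real \<Rightarrow> complex" where
  "mean_along_slope D' s t = integral {0..1} (\<lambda>x. x *\<^sub>R D' (t + x * (s - t)))"

lemma mean_along_slope_diag: "mean_along_slope D' t t = D' t / 2"
proof -
  have "((\<lambda>x::real. x) has_integral (1/2)) {0..1}"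
    using ident_has_integral[of 0 "1::real"] by simp
  then have "((\<lambda>x. x *\<^sub>R D' t) has_integral (1/2) *\<^sub>R D' t) {0..1}"
    using has_integral_linear[OF _ bounded_linear_scaleR_left, of "\<lambda>x. x" "1/2" "{0..1}" "D' t"]
    by (simp add: o_def)
  then have "integral {0..1} (\<lambda>x. x *\<^sub>R D' t) = (1/2) *\<^sub>R D' t"
    by (rule integral_unique)
  then show ?thesis
    unfolding mean_along_slope_def by (simp only: diff_self mult_zero_right add_0_right) (simp add: scaleR_conv_of_real)
qed

lemma has_vector_derivative_mean_along:
  assumes D: "\<And>x. (D has_vector_derivative D' x) (at x)" and D': "continuous_on UNIV D'"
  shows "((\<lambda>s. mean_along D s t) has_vector_derivative mean_along_slope D' s t) (at s)"
proof -
  have cD: "continuous_on UNIV D"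
    using D has_vector_derivative_continuous continuous_at_imp_continuous_on by blast
  have *: "((\<lambda>s. D (t + x * (s - t))) has_vector_derivative x *\<^sub>R D' (t + x * (s - t))) (at s)" for x s
  proof -
    have "((\<lambda>s. t + x * (s - t)) has_vector_derivative x) (at s)"
      by (auto intro!: derivative_eq_intros)
    from vector_diff_chain_at[OF this D] show ?thesis by (simp add: o_def)
  qed
  have "((\<lambda>s. integral (cbox 0 1) (\<lambda>x. D (t + x * (s - t)))) has_vector_derivative
      integral (cbox 0 1) (\<lambda>x. x *\<^sub>R D' (t + x * (s - t)))) (at s within UNIV)"
  proof (rule leibniz_rule_vector_derivative)
    show "(\<lambda>x. D (t + x * (s - t))) integrable_on cbox 0 1" for s
      by (intro integrable_continuous continuous_on_compose2[OF cD] continuous_intros) auto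
    show "continuous_on (UNIV \<times> cbox 0 1) (\<lambda>(s, x). x *\<^sub>R D' (t + x * (s - t)))"
      unfolding case_prod_unfold
      by (intro continuous_intros continuous_on_compose2[OF D']) auto
  qed (use * in auto)
  then show ?thesis by (simp add: mean_along_def[abs_def] mean_along_slope_def)
qed

lemma cis_eq_imp_eq:
  assumes "cis s = cis t" "\<bar>s - t\<bar> < 2 * pi" shows "s = t"
proof -
  have "sin s = sin t \<and> cos s = cos t" using assms(1) by (simp add: complex_eq_iff)
  then obtain n :: int where n: "s = t + 2 * pi * n" using sin_cos_eq_iff by blast
  then have "\<bar>real_of_int n\<bar> < 1" using assms(2) by (simp add: abs_mult)
  then have "n = 0" by linarith
  then show ?thesis using n by simp
qed

lemma has_vector_derivative_cis:
  "(cis has_vector_derivative \<i> * cis t) (at t)"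
  unfolding has_vector_derivative_def by (auto intro!: derivative_eq_intros)

lemma has_vector_derivative_i_cis:
  "((\<lambda>t. \<i> * cis t) has_vector_derivative - cis t) (at t)"
  using has_vector_derivative_mult_right[OF has_vector_derivative_cis, of \<i> t]
  by (simp add: mult.assoc[symmetric])

text \<open>
  A right inverse of \<open>cis\<close> on the circle that is continuous at \<open>cis \<alpha>\<close>; it transports limits from the line
  to the circle.
\<close>

definition local_lift :: "real \<Rightarrow> complex \<Rightarrow> real" where
  "local_lift \<alpha> z = \<alpha> + Arg (z / cis \<alpha>)"

lemma cis_local_lift: "z \<in> circle \<Longrightarrow> cis (local_lift \<alpha> z) = z"
  using circle_cis_Arg[of "z / cis \<alpha>"] by (simp add: local_lift_def cis_mult[symmetric] norm_divide)

lemma local_lift_tendsto: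
  assumes "(g \<longlongrightarrow> cis \<alpha>) F" shows "((\<lambda>x. local_lift \<alpha> (g x)) \<longlongrightarrow> \<alpha>) F"
proof -
  have "isCont Arg 1" by (rule continuous_at_Arg) auto
  moreover have "((\<lambda>x. g x / cis \<alpha>) \<longlongrightarrow> 1) F"
    using tendsto_divide[OF assms tendsto_const[of "cis \<alpha>"]] by simp
  ultimately have "((\<lambda>x. Arg (g x / cis \<alpha>)) \<longlongrightarrow> Arg 1) F"
    by (rule isCont_tendsto_compose)
  then have "((\<lambda>x. \<alpha> + Arg (g x / cis \<alpha>)) \<longlongrightarrow> \<alpha> + 0) F" by (intro tendsto_intros) simp
  then show ?thesis by (simp add: local_lift_def)
qed

text \<open>
  The divided difference with respect to the complex variable. The value for \<open>z = w\<close> is the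
  derivative along the circle, taken with respect to \<open>z\<close> and not to the angle.
\<close>

definition circle_slope :: "(complex \<Rightarrow> complex) \<Rightarrow> complex \<Rightarrow> complex \<Rightarrow> complex" where
  "circle_slope f z w =
    (if z = w then vector_derivative (\<lambda>t. f (z * cis t)) (at 0) / (\<i> * z) else (f z - f w) / (z - w))"

lemma circle_slope_mult: "circle_slope f z w * (z - w) = f z - f w"
  by (simp add: circle_slope_def)

lemma circle_slope_commute: "circle_slope f z w = circle_slope f w z"
  by (auto simp: circle_slope_def field_simps)

section \<open>Triples with coinciding points\<close>

lemma distinct3_subset: "distinct3 \<subseteq> circle3"
  by (auto simp: distinct3_def)

lemma closure_distinct3: "closure distinct3 = circle3"
proof
  show "closure distinct3 \<subseteq> circle3"
    by (intro closure_minimal distinct3_subset closed_Times) auto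
  show "circle3 \<subseteq> closure distinct3"
  proof safe
    fix a b c :: complex
    assume abc: "a \<in> circle" "b \<in> circle" "c \<in> circle"
    \<comment> \<open>The three points are moved along the circle with speeds 0, 1 and 2.\<close>
    define p where "p = (\<lambda>e. (a, b * cis e, c * cis (2 * e)))"
    have lim: "(p \<longlongrightarrow> (a, b, c)) (at 0)"
      unfolding p_def by (intro tendsto_eq_intros) (auto intro!: tendsto_eq_intros)
    have ne: "eventually (\<lambda>e. x * cis (k * e) \<noteq> y * cis (l * e)) (at 0)"
      if xy: "x \<in> circle" "y \<in> circle" "k \<noteq> l" for x y :: complex and k l :: real
    proof (cases "x = y")
      case True
      have "((\<lambda>e. \<bar>k * e - l * e\<bar>) \<longlongrightarrow> \<bar>k * 0 - l * 0\<bar>) (at 0)" by (intro tendsto_intros)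
      then have "eventually (\<lambda>e. \<bar>k * e - l * e\<bar> < 2 * pi) (at 0)"
        by (rule order_tendstoD) auto
      moreover have "eventually (\<lambda>e. e \<noteq> (0::real)) (at 0)" by (simp add: eventually_at_filter)
      ultimately show ?thesis
      proof eventually_elim
        case (elim e)
        then show ?case using cis_eq_imp_eq[of "k * e" "l * e"] True xy by auto
      qed
    next
      case False
      have "((\<lambda>e. x * cis (k * e) - y * cis (l * e)) \<longlongrightarrow> x * cis (k * 0) - y * cis (l * 0)) (at 0)"
        by (intro tendsto_intros)
      then have "eventually (\<lambda>e. x * cis (k * e) - y * cis (l * e) \<noteq> 0) (at 0)"
        by (rule tendsto_imp_eventually_ne) (use False in auto)
      then show ?thesis by simp
    qed
    have "eventually (\<lambda>e. p e \<in> distinct3) (at 0)"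
      using ne[OF abc(1,2), of 0 1, simplified] ne[OF abc(1,3), of 0 2, simplified]
        ne[OF abc(2,3), of 1 2, simplified]
      by eventually_elim (use abc in \<open>auto simp: p_def distinct3_def norm_mult\<close>)
    then have "eventually (\<lambda>e. p e \<in> closure distinct3) (at 0)"
      by eventually_elim (use closure_subset in blast)
    then show "(a, b, c) \<in> closure distinct3"
      using Lim_in_closed_set[OF closed_closure _ _ lim] by auto
  qed
qed

lemma continuous_on_circle3_eq:
  fixes g h :: "complex \<times> complex \<times> complex \<Rightarrow> 'a::real_normed_vector"
  assumes "continuous_on circle3 g" "continuous_on circle3 h"
    and "\<And>x. x \<in> distinct3 \<Longrightarrow> g x = h x" and "x \<in> circle3"
  shows "g x = h x"
proof -
  have "continuous_on (closure distinct3) (\<lambda>x. g x - h x)"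
    unfolding closure_distinct3 by (intro continuous_on_diff assms)
  from continuous_constant_on_closure[OF this, of 0 x]
  show ?thesis using assms by (simp only: closure_distinct3) simp
qed

lemma tendsto_within_distinct3:
  assumes "continuous_on circle3 k" "x \<in> circle3"
  shows "(k \<longlongrightarrow> k x) (at x within distinct3)"
  using assms tendsto_within_subset[OF _ distinct3_subset] unfolding continuous_on_def by blast

lemma at_within_distinct3_nontrivial:
  assumes "x \<in> circle3 - distinct3" shows "at x within distinct3 \<noteq> bot"
  using assms closure_distinct3 unfolding trivial_limit_within closure_def by blast

lemma atin_within_euclidean: "atin_within euclidean x S = (at x within S)"
  by (rule filter_eqI) (auto simp: eventually_atin_within eventually_at_topological)

text \<open>
  Complex numbers form a regular space, so limits at each missing point already make the extended
  function continuous.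
\<close>

lemma continuous_extension_circle3:
  fixes k :: "complex \<times> complex \<times> complex \<Rightarrow> complex"
  assumes k: "continuous_on distinct3 k"
    and L: "\<And>x. x \<in> circle3 - distinct3 \<Longrightarrow> (k \<longlongrightarrow> L x) (at x within distinct3)"
  obtains k' where "continuous_on circle3 k'" "\<And>x. x \<in> distinct3 \<Longrightarrow> k' x = k x"
    "\<And>x. x \<in> circle3 - distinct3 \<Longrightarrow> k' x = L x"
proof -
  have "continuous_map (subtopology euclidean distinct3) euclidean k" using k by simp
  moreover have "\<exists>l. limitin euclidean k l (atin_within euclidean x distinct3)"
    if "x \<in> circle3 - distinct3" for x
    using L[OF that]
    by (intro exI[of _ "L x"])
      (simp only: limitin_canonical_iff atin_within_euclidean)
  moreover have "circle3 \<subseteq> euclidean closure_of distinct3"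
    by (simp add: closure_distinct3)
  ultimately obtain k' where k': "continuous_map (subtopology euclidean circle3) euclidean k'"
      and eq: "\<And>x. x \<in> distinct3 \<Longrightarrow> k' x = k x"
    using continuous_map_extension_pointwise_alt[OF _ distinct3_subset, of euclidean euclidean k]
      metrizable_imp_regular_space[OF metrizable_space_euclidean] by blast
  have c: "continuous_on circle3 k'" using k' by simp
  have "k' x = L x" if x: "x \<in> circle3 - distinct3" for x
  proof -
    have "(k' \<longlongrightarrow> k' x) (at x within distinct3)"
      using tendsto_within_distinct3[OF c] x by blast
    \<comment> \<open>The extension theorem only gives existence; the value at \<open>x\<close> is forced by density.\<close>
    then have "(k \<longlongrightarrow> k' x) (at x within distinct3)"
      by (rule Lim_transform_eventually) (simp add: eventually_at_filter eq)
    moreover note at_within_distinct3_nontrivial[OF x]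
    ultimately show ?thesis using L[OF x] tendsto_unique by blast
  qed
  with c eq show ?thesis using that by blast
qed

section \<open>Second divided differences of a twice differentiable function\<close>

text \<open>
  In the angle, slopes with respect to the complex variable are quotients of two means, one for
  \<open>W\<close> and one for \<open>cis\<close>. The denominator vanishes only for angles that differ by a nonzero multiple
  of \<open>2 \<pi>\<close>, so the quotient is differentiable with continuous derivative near the diagonal.
\<close>

locale C2_on_circle =
  fixes f :: "complex \<Rightarrow> complex" and W W' W'' :: "real \<Rightarrow> complex"
  assumes f_cis: "\<And>t. f (cis t) = W t"
    and W: "\<And>t. (W has_vector_derivative W' t) (at t)"
    and W': "\<And>t. (W' has_vector_derivative W'' t) (at t)"
    and W'': "continuous_on UNIV W''"
begin

definition W_mean where "W_mean s t = mean_along W' s t"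
definition cis_mean where "cis_mean s t = mean_along (\<lambda>t. \<i> * cis t) s t"
definition W_mean_deriv where "W_mean_deriv s t = mean_along_slope W'' s t"
definition cis_mean_deriv where "cis_mean_deriv s t = mean_along_slope (\<lambda>t. - cis t) s t"
definition lift_slope where "lift_slope s t = W_mean s t / cis_mean s t"
definition lift_slope_deriv where
  "lift_slope_deriv s t =
    (W_mean_deriv s t * cis_mean s t - W_mean s t * cis_mean_deriv s t) / (cis_mean s t * cis_mean s t)"

lemma W_mean_mult: "W_mean s t * of_real (s - t) = W s - W t"
  unfolding W_mean_def by (rule mean_along_mult[of UNIV]) (use W in auto)

lemma cis_mean_mult: "cis_mean s t * of_real (s - t) = cis s - cis t"
  unfolding cis_mean_def by (rule mean_along_mult[of UNIV]) (use has_vector_derivative_cis in auto)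

lemma cis_mean_nonzero:
  assumes "\<bar>s - t\<bar> < 2 * pi" shows "cis_mean s t \<noteq> 0"
proof (cases "s = t")
  case True
  then show ?thesis by (simp add: cis_mean_def)
next
  case False
  then show ?thesis using cis_eq_imp_eq[OF _ assms] cis_mean_mult[of s t] by auto
qed

lemma lift_slope_mult:
  assumes "\<bar>s - t\<bar> < 2 * pi" shows "lift_slope s t * (cis s - cis t) = W s - W t"
  using cis_mean_nonzero[OF assms] by (simp add: lift_slope_def flip: W_mean_mult cis_mean_mult)

lemma circle_slope_cis:
  assumes "\<bar>s - t\<bar> < 2 * pi" shows "circle_slope f (cis s) (cis t) = lift_slope s t"
proof (cases "s = t")
  case True
  have "((\<lambda>h. s + h) has_vector_derivative 1) (at 0)"
    by (auto intro!: derivative_eq_intros)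
  then have "((W \<circ> (\<lambda>h. s + h)) has_vector_derivative 1 *\<^sub>R W' s) (at 0)"
    by (rule vector_diff_chain_at) (use W in auto)
  then have "((\<lambda>h. f (cis s * cis h)) has_vector_derivative W' s) (at 0)"
    by (simp add: o_def cis_mult f_cis)
  then show ?thesis
    by (simp add: True circle_slope_def vector_derivative_at lift_slope_def W_mean_def cis_mean_def)
next
  case False
  then have "cis s - cis t \<noteq> 0" using cis_eq_imp_eq[OF _ assms] by auto
  then show ?thesis
    using lift_slope_mult[OF assms] by (simp add: circle_slope_def f_cis field_simps)
qed

lemma continuous_W_mean_cis_mean:
  "continuous_on UNIV (\<lambda>(s, t). W_mean s t)" "continuous_on UNIV (\<lambda>(s, t). cis_mean s t)"
  "continuous_on UNIV (\<lambda>(s, t). W_mean_deriv s t)" "continuous_on UNIV (\<lambda>(s, t). cis_mean_deriv s t)"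
proof -
  have *: "continuous_on UNIV (\<lambda>(s, t). integral {0..1} (\<lambda>x. c x *\<^sub>R D (t + x * (s - t))))"
    if "continuous_on UNIV D" "continuous_on UNIV c" for D :: "real \<Rightarrow> complex" and c :: "real \<Rightarrow> real"
  proof -
    have "continuous_on (UNIV \<times> UNIV) (\<lambda>(s, p::real). D s)"
      unfolding case_prod_unfold by (intro continuous_on_compose2[OF that(1)] continuous_intros) auto
    from continuous_on_weighted_mean_along[OF convex_UNIV this that(2)]
    have c: "continuous_on UNIV (\<lambda>(s, t, p::real). integral {0..1} (\<lambda>x. c x *\<^sub>R D (t + x * (s - t))))"
      by simp
    have "continuous_on UNIV (\<lambda>y. (fst y, snd y, 0::real))" by (intro continuous_intros)
    from continuous_on_compose2[OF c this] show ?thesis by (simp add: case_prod_unfold)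
  qed
  have "continuous_on UNIV W'"
    using W' has_vector_derivative_continuous continuous_at_imp_continuous_on by blast
  from *[OF this, of "\<lambda>_. 1"] show "continuous_on UNIV (\<lambda>(s, t). W_mean s t)"
    by (simp add: W_mean_def mean_along_def)
  have "continuous_on UNIV (\<lambda>t. \<i> * cis t)" by (intro continuous_intros)
  from *[OF this, of "\<lambda>_. 1"] show "continuous_on UNIV (\<lambda>(s, t). cis_mean s t)"
    by (simp add: cis_mean_def mean_along_def)
  from *[OF W'', of "\<lambda>x. x"] show "continuous_on UNIV (\<lambda>(s, t). W_mean_deriv s t)"
    by (simp add: W_mean_deriv_def mean_along_slope_def)
  have "continuous_on UNIV (\<lambda>t. - cis t)" by (intro continuous_intros)
  from *[OF this, of "\<lambda>x. x"] show "continuous_on UNIV (\<lambda>(s, t). cis_mean_deriv s t)"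
    by (simp add: cis_mean_deriv_def mean_along_slope_def)
qed

lemma continuous_on_lift_slope: "continuous_on {(s, t). \<bar>s - t\<bar> < 2 * pi} (\<lambda>(s, t). lift_slope s t)"
  using cis_mean_nonzero continuous_W_mean_cis_mean[THEN continuous_on_subset, OF subset_UNIV]
  unfolding lift_slope_def case_prod_unfold by (intro continuous_intros) auto

lemma continuous_on_lift_slope_deriv: "continuous_on {(s, t). \<bar>s - t\<bar> < 2 * pi} (\<lambda>(s, t). lift_slope_deriv s t)"
  using cis_mean_nonzero continuous_W_mean_cis_mean[THEN continuous_on_subset, OF subset_UNIV]
  unfolding lift_slope_deriv_def case_prod_unfold by (intro continuous_intros) auto

lemma open_near_diagonal: "open {(s, t). \<bar>s - t\<bar> < (2 * pi :: real)}"
proof -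
  have "open {x :: real \<times> real. \<bar>fst x - snd x\<bar> < 2 * pi}"
    by (intro open_Collect_less continuous_intros)
  then show ?thesis by (simp add: case_prod_unfold)
qed

lemma lift_slope_derivative:
  assumes "\<bar>s - t\<bar> < 2 * pi"
  shows "((\<lambda>s. lift_slope s t) has_vector_derivative lift_slope_deriv s t) (at s)"
proof -
  have n: "((\<lambda>s. W_mean s t) has_vector_derivative W_mean_deriv s t) (at s)"
    unfolding W_mean_def W_mean_deriv_def by (rule has_vector_derivative_mean_along[OF W' W''])
  have d: "((\<lambda>s. cis_mean s t) has_vector_derivative cis_mean_deriv s t) (at s)"
    unfolding cis_mean_def cis_mean_deriv_def
    by (rule has_vector_derivative_mean_along[OF has_vector_derivative_i_cis]) (intro continuous_intros)
  have "(\<lambda>h. ((h *\<^sub>R W_mean_deriv s t) * cis_mean s t - W_mean s t * (h *\<^sub>R cis_mean_deriv s t)) / (cis_mean s t * cis_mean s t))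
      = (\<lambda>h. h *\<^sub>R lift_slope_deriv s t)"
    by (simp add: fun_eq_iff lift_slope_deriv_def scaleR_conv_of_real right_diff_distrib mult_ac)
  then show ?thesis
    using has_derivative_divide'[OF n[unfolded has_vector_derivative_def]
        d[unfolded has_vector_derivative_def] cis_mean_nonzero[OF assms]]
    unfolding has_vector_derivative_def lift_slope_def by simp
qed

lemma continuous_on_circle_slope: "continuous_on (circle \<times> circle) (\<lambda>(z, w). circle_slope f z w)"
  unfolding continuous_on_def
proof safe
  fix a b :: complex assume ab: "a \<in> circle" "b \<in> circle"
  define \<alpha> where "\<alpha> = Arg a"
  define \<beta> where "\<beta> = Arg b"
  have cis: "cis \<alpha> = a" "cis \<beta> = b" using ab circle_cis_Arg by (simp_all add: \<alpha>_def \<beta>_def)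
  have near: "\<bar>\<alpha> - \<beta>\<bar> < 2 * pi"
    using Arg_bounded[of a] Arg_bounded[of b] unfolding \<alpha>_def \<beta>_def by linarith
  let ?F = "at (a, b) within circle \<times> circle"
  have l1: "((\<lambda>x. local_lift \<alpha> (fst x)) \<longlongrightarrow> \<alpha>) ?F" 
    by (rule local_lift_tendsto) (auto simp: cis intro!: tendsto_eq_intros)
  have l2: "((\<lambda>x. local_lift \<beta> (snd x)) \<longlongrightarrow> \<beta>) ?F" 
    by (rule local_lift_tendsto) (auto simp: cis intro!: tendsto_eq_intros)
  have "isCont (\<lambda>(s, t). lift_slope s t) (\<alpha>, \<beta>)"
    using continuous_on_lift_slope open_near_diagonal near by (simp add: continuous_on_eq_continuous_at)
  from isCont_tendsto_compose[OF this tendsto_Pair[OF l1 l2]]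
  have "((\<lambda>x. lift_slope (local_lift \<alpha> (fst x)) (local_lift \<beta> (snd x))) \<longlongrightarrow> lift_slope \<alpha> \<beta>) ?F"
    by simp
  moreover have "eventually (\<lambda>x. \<bar>local_lift \<alpha> (fst x) - local_lift \<beta> (snd x)\<bar> < 2 * pi) ?F"
    using near by (intro order_tendstoD(2)[OF tendsto_rabs[OF tendsto_diff[OF l1 l2]]])
  moreover have "eventually (\<lambda>x. x \<in> circle \<times> circle) ?F" by (simp add: eventually_at_filter)
  ultimately have lim: "((\<lambda>x. lift_slope (local_lift \<alpha> (fst x)) (local_lift \<beta> (snd x))) \<longlongrightarrow> lift_slope \<alpha> \<beta>) ?F"
    and ev: "eventually (\<lambda>x. \<bar>local_lift \<alpha> (fst x) - local_lift \<beta> (snd x)\<bar> < 2 * pi) ?F"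
      "eventually (\<lambda>x. x \<in> circle \<times> circle) ?F" by blast+
  from ev have "eventually (\<lambda>x. lift_slope (local_lift \<alpha> (fst x)) (local_lift \<beta> (snd x))
      = (\<lambda>(z, w). circle_slope f z w) x) ?F"
  proof eventually_elim
    case (elim x)
    then have "fst x \<in> circle" "snd x \<in> circle" by auto
    then show ?case
      using circle_slope_cis[OF elim(1)] by (simp add: cis_local_lift case_prod_unfold del: mem_sphere_0)
  qed
  from Lim_transform_eventually[OF lim this]
  show "((\<lambda>(z, w). circle_slope f z w) \<longlongrightarrow> circle_slope f a b) ?F"
    using circle_slope_cis[OF near] cis by simp
qed

text \<open>
  The second difference is again a quotient of means: of the partial derivative of the slope over
  the derivative of \<open>cis\<close>, with the third point as parameter.
\<close>

lemma second_difference_tendsto: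
  "((\<lambda>(a, b, c). (circle_slope f a c - circle_slope f b c) / (a - b))
      \<longlongrightarrow> lift_slope_deriv \<alpha> \<alpha> / (\<i> * cis \<alpha>)) (at (cis \<alpha>, cis \<alpha>, cis \<alpha>) within distinct3)"
proof -
  define I where "I = {\<alpha> - 1<..<\<alpha> + 1}"
  have pi: "(1::real) < pi" using pi_gt3 by simp
  have near: "\<bar>s - t\<bar> < 2 * pi" if "s \<in> I" "t \<in> I" for s t
    using that pi by (auto simp: I_def)
  have "I \<times> I \<subseteq> {(s, t). \<bar>s - t\<bar> < 2 * pi}" using near by auto
  then have "continuous_on (I \<times> I) (\<lambda>(s, t). lift_slope_deriv s t)"
    using continuous_on_lift_slope_deriv continuous_on_subset by blast
  from continuous_on_mean_along[OF _ this]
  have c: "continuous_on (I \<times> I \<times> I) (\<lambda>(s, t, r). mean_along (\<lambda>s. lift_slope_deriv s r) s t)"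
    by (simp add: I_def)
  have "continuous_on (I \<times> I \<times> I) (\<lambda>x. (fst x, fst (snd x)))" by (intro continuous_intros)
  from continuous_on_compose2[OF continuous_W_mean_cis_mean(2) this]
  have c2: "continuous_on (I \<times> I \<times> I) (\<lambda>x. cis_mean (fst x) (fst (snd x)))" by simp
  define K where "K = (\<lambda>(s, t, r). mean_along (\<lambda>s. lift_slope_deriv s r) s t / cis_mean s t)"
  have "continuous_on (I \<times> I \<times> I) K"
    using c c2 near cis_mean_nonzero unfolding K_def case_prod_unfold by (intro continuous_on_divide) auto
  moreover have "open (I \<times> I \<times> I)" by (intro open_Times) (auto simp: I_def)
  ultimately have "isCont K (\<alpha>, \<alpha>, \<alpha>)"
    by (auto simp: continuous_on_eq_continuous_at I_def)
  let ?F = "at (cis \<alpha>, cis \<alpha>, cis \<alpha>) within distinct3"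
  let ?l = "local_lift \<alpha>"
  have l1: "((\<lambda>x. ?l (fst x)) \<longlongrightarrow> \<alpha>) ?F"
    by (rule local_lift_tendsto) (auto intro!: tendsto_eq_intros)
  have l2: "((\<lambda>x. ?l (fst (snd x))) \<longlongrightarrow> \<alpha>) ?F"
    by (rule local_lift_tendsto) (auto intro!: tendsto_eq_intros)
  have l3: "((\<lambda>x. ?l (snd (snd x))) \<longlongrightarrow> \<alpha>) ?F"
    by (rule local_lift_tendsto) (auto intro!: tendsto_eq_intros)
  have op: "open I" "\<alpha> \<in> I" by (auto simp: I_def)
  have lim: "((\<lambda>x. K (?l (fst x), ?l (fst (snd x)), ?l (snd (snd x)))) \<longlongrightarrow> K (\<alpha>, \<alpha>, \<alpha>)) ?F"
    by (rule isCont_tendsto_compose[OF \<open>isCont K _\<close>]) (intro tendsto_Pair l1 l2 l3)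
  have "eventually (\<lambda>x. x \<in> distinct3) ?F" by (simp add: eventually_at_filter)
  then have "eventually (\<lambda>x. K (?l (fst x), ?l (fst (snd x)), ?l (snd (snd x)))
      = (\<lambda>(a, b, c). (circle_slope f a c - circle_slope f b c) / (a - b)) x) ?F"
    using topological_tendstoD[OF l1 op] topological_tendstoD[OF l2 op] topological_tendstoD[OF l3 op]
  proof eventually_elim
    case (elim x)
    obtain a b c where x: "x = (a, b, c)" by (cases x)
    define s where "s = ?l a"
    define t where "t = ?l b"
    define r where "r = ?l c"
    have I: "s \<in> I" "t \<in> I" "r \<in> I" using elim by (simp_all add: x s_def t_def r_def)
    have abc: "a \<in> circle" "b \<in> circle" "c \<in> circle" "a \<noteq> b"
      using elim(1) by (auto simp: x distinct3_def)
    have cis: "cis s = a" "cis t = b" "cis r = c"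
      using abc by (simp_all add: s_def t_def r_def cis_local_lift del: mem_sphere_0)
    have "mean_along (\<lambda>s. lift_slope_deriv s r) s t * of_real (s - t) = lift_slope s r - lift_slope t r"
      by (rule mean_along_mult[OF _ I(1,2)]) (use lift_slope_derivative near I in \<open>auto simp: I_def\<close>)
    moreover have "lift_slope s r = circle_slope f a c" "lift_slope t r = circle_slope f b c"
      using circle_slope_cis near I cis by metis+
    moreover have "cis_mean s t * of_real (s - t) = a - b" using cis_mean_mult cis by simp
    moreover have "cis_mean s t \<noteq> 0" using cis_mean_nonzero near I by blast
    ultimately show ?case
      using abc(4) by (simp add: x K_def field_simps flip: s_def t_def r_def) algebra
  qed
  from Lim_transform_eventually[OF lim this] show ?thesis by (simp add: K_def cis_mean_def)
qed

text \<open>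
  The second difference is symmetric in the three points. Hence, as long as the limit triple is not
  constant, two different points of it may be used in the denominator and continuity is clear; the
  constant triples are covered by the previous lemma.
\<close>

lemma second_slope_exists:
  obtains k where "continuous_on circle3 k"
    "\<And>a b c. (a, b, c) \<in> distinct3 \<Longrightarrow> k (a, b, c) * (a - b) = circle_slope f a c - circle_slope f b c"
    "\<And>t. k (cis t, cis t, cis t) = (\<i> * W' t - W'' t) / (2 * cis t ^ 2)"
proof -
  let ?k = "\<lambda>(a, b, c). (circle_slope f a c - circle_slope f b c) / (a - b)"
  let ?k' = "\<lambda>(a, b, c). (circle_slope f a b - circle_slope f c b) / (a - c)"
  have k_eq: "?k x = ?k' x" if "x \<in> distinct3" for x
  proof -
    obtain a b c where x: "x = (a, b, c)" by (cases x)
    then have "a - b \<noteq> 0" "a - c \<noteq> 0" "b - c \<noteq> 0" using that by (auto simp: distinct3_def)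
    then have "((f a - f c) / (a - c) - (f b - f c) / (b - c)) / (a - b)
        = ((f a - f b) / (a - b) - (f c - f b) / (c - b)) / (a - c)"
      by (simp add: divide_simps) (simp add: algebra_simps)
    then show ?thesis using that by (auto simp: x distinct3_def circle_slope_def)
  qed
  have slope: "((\<lambda>x. circle_slope f (p x) (q x)) \<longlongrightarrow> circle_slope f (p y) (q y)) (at y within distinct3)"
    if p: "continuous_on circle3 p" "p ` circle3 \<subseteq> circle" and q: "continuous_on circle3 q" "q ` circle3 \<subseteq> circle"
      and y: "y \<in> circle3" for p q y
  proof -
    have "continuous_on circle3 (\<lambda>x. (\<lambda>(z, w). circle_slope f z w) (p x, q x))"
      by (rule continuous_on_compose2[OF continuous_on_circle_slope])
        (use p q in \<open>auto intro!: continuous_on_Pair\<close>)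
    from tendsto_within_distinct3[OF this y] show ?thesis by simp
  qed
  have fst': "continuous_on circle3 fst" "fst ` circle3 \<subseteq> circle"
    "continuous_on circle3 (\<lambda>x. fst (snd x))" "(\<lambda>x. fst (snd x)) ` circle3 \<subseteq> circle"
    "continuous_on circle3 (\<lambda>x. snd (snd x))" "(\<lambda>x. snd (snd x)) ` circle3 \<subseteq> circle"
    by (auto intro!: continuous_intros)
  have lim1: "(?k \<longlongrightarrow> ?k y) (at y within distinct3)" if "y \<in> circle3" "fst y \<noteq> fst (snd y)" for y
    unfolding case_prod_unfold using that
    by (intro tendsto_divide tendsto_diff slope[OF fst'(1,2,5,6)] slope[OF fst'(3,4,5,6)]
        tendsto_within_distinct3 fst') auto
  have lim2: "(?k \<longlongrightarrow> ?k' y) (at y within distinct3)" if y: "y \<in> circle3" "fst y \<noteq> snd (snd y)" for y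
  proof -
    have "(?k' \<longlongrightarrow> ?k' y) (at y within distinct3)"
      unfolding case_prod_unfold using y
      by (intro tendsto_divide tendsto_diff slope[OF fst'(1,2,3,4)] slope[OF fst'(5,6,3,4)]
          tendsto_within_distinct3 fst') auto
    then show ?thesis
      by (rule Lim_transform_eventually) (simp add: eventually_at_filter k_eq)
  qed
  define L where "L = (\<lambda>y. if fst y \<noteq> fst (snd y) then ?k y else if fst y \<noteq> snd (snd y) then ?k' y
      else lift_slope_deriv (Arg (fst y)) (Arg (fst y)) / (\<i> * fst y))"
  have lim: "(?k \<longlongrightarrow> L y) (at y within distinct3)" if y: "y \<in> circle3" for y
  proof (cases "fst y \<noteq> fst (snd y) \<or> fst y \<noteq> snd (snd y)")
    case True
    then show ?thesis using lim1[OF y] lim2[OF y] by (auto simp: L_def)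
  next
    case False
    obtain a b c where abc: "y = (a, b, c)" by (cases y)
    with False y have "a \<in> circle" "y = (a, a, a)" by auto
    then show ?thesis
      using second_difference_tendsto[of "Arg a"] circle_cis_Arg[of a] by (simp add: L_def)
  qed
  have "continuous_on distinct3 ?k"
    unfolding continuous_on_def using lim1 distinct3_subset by (auto simp: distinct3_def)
  then obtain k where k: "continuous_on circle3 k" "\<And>x. x \<in> distinct3 \<Longrightarrow> k x = ?k x"
    "\<And>x. x \<in> circle3 - distinct3 \<Longrightarrow> k x = L x"
    using continuous_extension_circle3[of ?k L] lim by blast
  show ?thesis
  proof (rule that[OF k(1)])
    show "k (a, b, c) * (a - b) = circle_slope f a c - circle_slope f b c" if "(a, b, c) \<in> distinct3" for a b c
      using k(2)[OF that] that by (auto simp: distinct3_def)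
    fix t
    have x: "(cis t, cis t, cis t) \<in> circle3 - distinct3" by (auto simp: distinct3_def)
    define k0 where "k0 = k (cis t, cis t, cis t)"
    have "(k \<longlongrightarrow> k0) (at (cis t, cis t, cis t) within distinct3)"
      using tendsto_within_distinct3[OF k(1)] x by (simp add: k0_def)
    then have "(?k \<longlongrightarrow> k0) (at (cis t, cis t, cis t) within distinct3)"
      by (rule Lim_transform_eventually) (simp add: eventually_at_filter k(2))
    moreover note at_within_distinct3_nontrivial[OF x]
    ultimately have "k0 = lift_slope_deriv t t / (\<i> * cis t)"
      using second_difference_tendsto[of t] tendsto_unique by blast
    also have "\<dots> = (\<i> * W' t - W'' t) / (2 * cis t ^ 2)"
    proof -
      have "lift_slope_deriv t t = (W'' t / 2 * (\<i> * cis t) - W' t * (- cis t / 2)) / (\<i> * cis t * (\<i> * cis t))"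
        by (simp add: lift_slope_deriv_def W_mean_deriv_def cis_mean_deriv_def W_mean_def cis_mean_def mean_along_slope_diag)
      then have "2 * (lift_slope_deriv t t * (\<i> * cis t * (\<i> * cis t))) = W'' t * (\<i> * cis t) + W' t * cis t"
        by (simp only: divide_eq_eq) simp
      moreover have i: "\<i> * \<i> = -1" by simp
      ultimately have "cis t * (2 * cis t * lift_slope_deriv t t + (\<i> * W'' t + W' t)) = 0"
        by algebra
      then have "2 * cis t * lift_slope_deriv t t + (\<i> * W'' t + W' t) = 0"
        by (metis cis_neq_zero mult_eq_0_iff)
      then have "2 * cis t * lift_slope_deriv t t = - (\<i> * W'' t + W' t)"
        by (simp only: eq_neg_iff_add_eq_0)
      with i have "lift_slope_deriv t t * (2 * cis t ^ 2) = (\<i> * W' t - W'' t) * (\<i> * cis t)"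
        by algebra
      then show ?thesis by (simp add: frac_eq_eq)
    qed
    finally show "k (cis t, cis t, cis t) = (\<i> * W' t - W'' t) / (2 * cis t ^ 2)"
      by (simp add: k0_def)
  qed
qed

end

section \<open>Lifts of circle diffeomorphisms\<close>

text \<open>
  The values of \<open>D\<close> are multiples of \<open>2 \<pi>\<close>, so continuity makes \<open>D\<close> locally constant.
\<close>

lemma constant_if_cis_eq_1:
  assumes D: "continuous_on UNIV D" and cis: "\<And>t::real. cis (D t) = 1"
  shows "D s = D t"
proof (rule DERIV_isconst_all[where f = D])
  show "\<forall>t. (D has_real_derivative 0) (at t)"
  proof
    fix t
    have "(D \<longlongrightarrow> D t) (nhds t)"
      using D by (metis continuous_on_def UNIV_I tendsto_at_iff_tendsto_nhds)
    then have "((\<lambda>s. \<bar>D s - D t\<bar>) \<longlongrightarrow> \<bar>D t - D t\<bar>) (nhds t)" by (intro tendsto_intros)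
    then have "eventually (\<lambda>s. \<bar>D s - D t\<bar> < 2 * pi) (nhds t)"
      by (rule order_tendstoD) auto
    then have "eventually (\<lambda>s. D s = D t) (nhds t)"
      by eventually_elim (use cis_eq_imp_eq cis in metis)
    from DERIV_cong_ev[OF refl this refl, of 0] show "(D has_real_derivative 0) (at t)" by simp
  qed
qed

definition C2_lift where
  "C2_lift f F F' F'' \<longleftrightarrow> (\<forall>t. f (cis t) = cis (F t)) \<and>
    (\<forall>t. (F has_real_derivative F' t) (at t)) \<and> (\<forall>t. (F' has_real_derivative F'' t) (at t)) \<and>
    continuous_on UNIV F'' \<and> (\<forall>t. 0 < F' t) \<and> (\<forall>t. F (t + 2 * pi) = F t + 2 * pi)"

text \<open>
  The twice differentiable lift differs from the increasing one by a constant, so it is increasing.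
  Its derivative cannot vanish because the inverse map has a differentiable lift too, and
  injectivity on the circle excludes degree larger than one.
\<close>

lemma C2_diffeo_lift:
  assumes f: "f \<in> C2_diffeos"
  obtains F F' F'' where "C2_lift f F F' F''"
proof -
  obtain F1 where F1: "continuous_on UNIV F1" "strict_mono F1" "lifts F1 f"
    using f by (auto simp: C2_diffeos_def orientation_preserving_def)
  obtain F where "C2_real F" and lift: "lifts F f"
    using f by (auto simp: C2_diffeos_def C2_circle_map_def)
  then obtain F' F'' where F: "\<And>t. (F has_real_derivative F' t) (at t)"
      "\<And>t. (F' has_real_derivative F'' t) (at t)" "continuous_on UNIV F''"
    by (auto simp: C2_real_def)
  obtain H H' where H: "\<And>t. (H has_real_derivative H' t) (at t)" and liftH: "lifts H (inv_into circle f)"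
    using f by (auto simp: C2_diffeos_def C2_circle_map_def C2_real_def)
  have inj: "inj_on f circle" using f by (auto simp: C2_diffeos_def Bij_def bij_betw_def)
  have fF: "f (cis t) = cis (F t)" for t using lift by (simp add: lifts_def)
  have cF: "continuous_on UNIV F"
    using F(1) DERIV_isCont continuous_at_imp_continuous_on by blast
  have diff: "F t - F1 t = F 0 - F1 0" for t
  proof (rule constant_if_cis_eq_1[where D = "\<lambda>t. F t - F1 t"])
    show "continuous_on UNIV (\<lambda>t. F t - F1 t)" by (intro continuous_intros cF F1)
    show "cis (F t - F1 t) = 1" for t
      using lift F1(3) by (simp add: lifts_def flip: cis_divide)
  qed
  have mono: "strict_mono F"
  proof (rule strict_monoI)
    fix x y :: real assume "x < y"
    then have "F1 x < F1 y" using F1(2) by (simp add: strict_mono_def)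
    then show "F x < F y" using diff[of x] diff[of y] by linarith
  qed
  have cH: "continuous_on UNIV H"
    using H DERIV_isCont continuous_at_imp_continuous_on by blast
  have HF: "H (F s) - s = H (F t) - t" for s t
  proof (rule constant_if_cis_eq_1[where D = "\<lambda>t. H (F t) - t"])
    show "continuous_on UNIV (\<lambda>t. H (F t) - t)"
      by (intro continuous_intros continuous_on_compose2[OF cH] cF) auto
    fix t
    have "cis (H (F t)) = cis t"
      using liftH fF inj by (metis lifts_def inv_into_f_f mem_sphere_0 norm_cis)
    then show "cis (H (F t) - t) = 1" by (simp flip: cis_divide)
  qed
  have "(\<lambda>t. H (F t)) = (\<lambda>t. t + H (F 0))"
  proof
    show "H (F t) = t + H (F 0)" for t using HF[of t 0] by linarith
  qed
  moreover have "((\<lambda>t. t + H (F 0)) has_real_derivative 1) (at t)" for t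
    by (auto intro!: derivative_eq_intros)
  moreover have "((\<lambda>t. H (F t)) has_real_derivative H' (F t) * F' t) (at t)" for t
    by (rule DERIV_chain2[OF H F(1)])
  ultimately have "H' (F t) * F' t = 1" for t by (metis DERIV_unique)
  then have "F' t \<noteq> 0" for t by (metis mult_zero_right zero_neq_one)
  moreover have "F' t \<ge> 0" for t
    using mono_on_imp_deriv_nonneg[of UNIV F "F' t" t] F(1) mono
    by (simp add: strict_mono_mono)
  ultimately have pos: "F' t > 0" for t by (metis order_le_less)
  define d where "d = F (2 * pi) - F 0"
  have per: "F (t + 2 * pi) - F t = F (0 + 2 * pi) - F 0" for t
  proof (rule constant_if_cis_eq_1[where D = "\<lambda>t. F (t + 2 * pi) - F t"])
    show "continuous_on UNIV (\<lambda>t. F (t + 2 * pi) - F t)"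
      by (intro continuous_intros continuous_on_compose2[OF cF]) auto
    have "cis (t + 2 * pi) = cis t" for t by (simp flip: cis_mult)
    then show "cis (F (t + 2 * pi) - F t) = 1" for t
      by (metis fF cis_divide cis_neq_zero divide_self)
  qed
  have "d > 0" using mono by (simp add: d_def strict_mono_def)
  have "cis d = 1"
    using fF[of 0] fF[of "2 * pi"] by (simp add: d_def flip: cis_divide)
  have "d = 2 * pi"
  proof (rule ccontr)
    assume "d \<noteq> 2 * pi"
    moreover have "\<not> d < 2 * pi"
      using cis_eq_imp_eq[of d 0] \<open>cis d = 1\<close> \<open>d > 0\<close> by auto
    ultimately have "d > 2 * pi" by simp
    then have "F 0 \<le> F 0 + 2 * pi" "F 0 + 2 * pi \<le> F (2 * pi)" by (simp_all add: d_def)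
    then obtain s where s: "0 \<le> s" "s \<le> 2 * pi" "F s = F 0 + 2 * pi"
      using IVT'[of F 0 "F 0 + 2 * pi" "2 * pi"] continuous_on_subset[OF cF] by auto
    have "s \<noteq> 2 * pi" using s \<open>d > 2 * pi\<close> by (auto simp: d_def)
    moreover have "f (cis s) = f (cis 0)"
      using fF[of 0] fF[of s] s by (simp flip: cis_mult)
    then have "cis s = cis 0" using inj by (auto dest: inj_onD)
    ultimately have "s = 0" using cis_eq_imp_eq[of s 0] s by auto
    then show False using s by simp
  qed
  then have "F (t + 2 * pi) = F t + 2 * pi" for t using per[of t] by (simp add: d_def)
  then have "C2_lift f F F' F''" unfolding C2_lift_def using fF F pos by blast
  then show ?thesis using that by blast
qed

lemma cis_diff: "cis x - cis y = 2 * \<i> * of_real (sin ((x - y) / 2)) * cis ((x + y) / 2)"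
proof -
  have xy: "x = (x + y) / 2 + (x - y) / 2" "y = (x + y) / 2 - (x - y) / 2"
    by (simp_all add: field_simps)
  define m where "m = (x + y) / 2"
  define h where "h = (x - y) / 2"
  have "cis (m + h) - cis (m - h) = 2 * \<i> * of_real (sin h) * cis m"
    by (simp add: complex_eq_iff cos_add cos_diff sin_add sin_diff)
  then show ?thesis using xy by (simp add: m_def h_def)
qed

text \<open>
  The chord \<open>cis x - cis y\<close> has the direction of \<open>\<i> cis ((x + y) / 2)\<close> up to the sign of
  \<open>sin ((x - y) / 2)\<close>. An increasing lift of degree one preserves this sign, which is where
  the orientation enters.
\<close>

lemma circle_slope_polar:
  assumes "C2_lift f F F' F''" and st: "\<bar>s - t\<bar> < 2 * pi"
  shows "\<exists>S>0. circle_slope f (cis s) (cis t) = of_real S * cis ((F s + F t) / 2 - (s + t) / 2)"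
proof -
  have F: "f (cis t) = cis (F t)" "(F has_real_derivative F' t) (at t)"
    "0 < F' t" "F (t + 2 * pi) = F t + 2 * pi" for t
    using assms by (auto simp: C2_lift_def)
  have mono: "F x < F y" if "x < y" for x y
    using DERIV_pos_imp_increasing[OF that] F by blast
  have offdiag: "\<exists>S>0. circle_slope f (cis s) (cis t) = of_real S * cis ((F s + F t) / 2 - (s + t) / 2)"
    if st: "t < s" "s < t + 2 * pi" for s t
  proof -
    define S where "S = sin ((F s - F t) / 2) / sin ((s - t) / 2)"
    have "F s < F t + 2 * pi" using mono[OF st(2)] F(4) by simp
    then have n: "sin ((F s - F t) / 2) > 0" using mono[OF st(1)] by (intro sin_gt_zero) auto
    have d: "sin ((s - t) / 2) > 0" using st by (intro sin_gt_zero) auto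
    have "circle_slope f (cis s) (cis t) = (cis (F s) - cis (F t)) / (cis s - cis t)"
      using cis_eq_imp_eq[of s t] st by (auto simp: circle_slope_def F)
    also have "\<dots> = of_real S * cis ((F s + F t) / 2 - (s + t) / 2)"
      unfolding cis_diff using n d by (simp add: S_def flip: cis_divide)
    finally show ?thesis using n d by (intro exI[of _ S]) (simp add: S_def)
  qed
  consider "s = t" | "t < s" | "s < t" by linarith
  then show ?thesis
  proof cases
    case 1
    have "((\<lambda>h. F (s + h)) has_real_derivative F' s) (at 0)"
      using F(2)[of s] DERIV_shift[of F "F' s" 0 s] by (simp add: add.commute)
    then have "((\<lambda>h. cis (F (s + h))) has_vector_derivative F' s *\<^sub>R (\<i> * cis (F (s + 0)))) (at 0)"
      unfolding has_vector_derivative_def has_field_derivative_def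
      by (auto intro!: derivative_eq_intros simp: fun_eq_iff mult.commute)
    then have "((\<lambda>h. f (cis s * cis h)) has_vector_derivative F' s *\<^sub>R (\<i> * cis (F s))) (at 0)"
      by (simp add: cis_mult F)
    then have "circle_slope f (cis s) (cis s) = of_real (F' s) * cis (F s - s)"
      by (simp add: circle_slope_def vector_derivative_at scaleR_conv_of_real flip: cis_divide)
    then show ?thesis using 1 F(3)[of s] by (intro exI[of _ "F' s"]) (simp add: field_simps)
  next
    case 2
    then show ?thesis using offdiag st by auto
  next
    case 3
    then show ?thesis using offdiag[of s t] st by (auto simp: circle_slope_commute add.commute)
  qed
qed

lemma C2_lift_imp_C2_on_circle:
  assumes "C2_lift f F F' F''"
  shows "C2_on_circle f (\<lambda>t. cis (F t)) (\<lambda>t. \<i> * of_real (F' t) * cis (F t))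
    (\<lambda>t. (\<i> * of_real (F'' t) - of_real (F' t) ^ 2) * cis (F t))"
proof
  have F: "(F has_real_derivative F' t) (at t)" "(F' has_real_derivative F'' t) (at t)" for t
    using assms by (auto simp: C2_lift_def)
  have cF: "continuous_on UNIV F" "continuous_on UNIV F'"
    using F DERIV_isCont continuous_at_imp_continuous_on by blast+
  show "f (cis t) = cis (F t)" for t using assms by (simp add: C2_lift_def)
  show W: "((\<lambda>t. cis (F t)) has_vector_derivative \<i> * of_real (F' t) * cis (F t)) (at t)" for t
    using F(1)[of t] unfolding has_vector_derivative_def has_field_derivative_def
    by (auto intro!: derivative_eq_intros simp: fun_eq_iff scaleR_conv_of_real)
  have "((\<lambda>t. of_real (F' t)) has_vector_derivative of_real (F'' t)) (at t)" for t
    using F(2)[of t] has_vector_derivative_of_real has_real_derivative_iff_has_vector_derivative by blast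
  from has_vector_derivative_mult[OF has_vector_derivative_mult_right[OF this] W]
  show "((\<lambda>t. \<i> * of_real (F' t) * cis (F t)) has_vector_derivative
      (\<i> * of_real (F'' t) - of_real (F' t) ^ 2) * cis (F t)) (at t)" for t
    by (rule has_vector_derivative_eq_rhs) (simp add: algebra_simps power2_eq_square)
  show "continuous_on UNIV (\<lambda>t. (\<i> * of_real (F'' t) - of_real (F' t) ^ 2) * cis (F t))"
    using assms by (intro continuous_intros cF) (auto simp: C2_lift_def)
qed

section \<open>The enlarged cocycle in coordinates\<close>

text \<open>
  Capital letters stand for the values at the points \<open>a\<close>, \<open>b\<close>, \<open>c\<close>. For \<open>cnj \<sigma> = k / e\<close> the first
  three equations say that \<open>1 - cnj \<sigma> z\<close> is, at each of the points, the slope between the other two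
  divided by \<open>e\<close>; together with the conjugates of the slopes this determines \<open>(z - \<sigma>) / (1 - cnj \<sigma> z)\<close>
  at the three points. The last equation decides whether \<open>\<bar>\<sigma>\<bar> < 1\<close>. Conjugation is inversion on the
  circle, which makes everything rational in the points and the values.
\<close>

lemma moebius_interpolation_algebra:
  fixes a b c A B C :: complex
  assumes circ: "a \<in> circle" "b \<in> circle" "c \<in> circle" "A \<in> circle" "B \<in> circle" "C \<in> circle"
    and neq: "a \<noteq> b" "a \<noteq> c" "b \<noteq> c"
    and ab: "gab * (a - b) = A - B" and ac: "gac * (a - c) = A - C" and bc: "gbc * (b - c) = B - C"
    and k: "k * (a - b) = gac - gbc"
  defines "e \<equiv> gac + b * k"
  shows "e - a * k = gbc" "e - b * k = gac" "e - c * k = gab"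
    and "cnj gab * (A * B) = gab * (a * b)" "cnj gac * (A * C) = gac * (a * c)"
      "cnj gbc * (B * C) = gbc * (b * c)"
    and "(e * cnj e - k * cnj k) * (A * B * C) = gab * gac * gbc * (a * b * c)"
proof -
  show e: "e - a * k = gbc" "e - b * k = gac"
    using k by (auto simp: e_def algebra_simps)
  have "(a - b) * (k * (b - c) - (gab - gac)) = 0" using ab ac bc k by algebra
  then have k': "k * (b - c) = gab - gac" using neq by simp
  then show e': "e - c * k = gab" unfolding e_def by algebra
  have cnj_slope: "cnj g * (W * V) = g * (w * v)"
    if g: "g * (w - v) = W - V" and "w \<noteq> v" "w \<in> circle" "v \<in> circle" "W \<in> circle" "V \<in> circle"
    for g w v W V
  proof -
    have n: "w * cnj w = 1" "v * cnj v = 1" "W * cnj W = 1" "V * cnj V = 1"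
      using that circle_cnj by blast+
    have "cnj g * (cnj w - cnj v) = cnj W - cnj V" using arg_cong[OF g, of cnj] by simp
    then have "(w - v) * (cnj g * (W * V) - g * (w * v)) = 0" using g n by algebra
    then show ?thesis using that(2) by simp
  qed
  show cab: "cnj gab * (A * B) = gab * (a * b)" and cac: "cnj gac * (A * C) = gac * (a * c)"
    and cbc: "cnj gbc * (B * C) = gbc * (b * c)"
    using cnj_slope ab ac bc circ neq by blast+
  have n: "a * cnj a = 1" "b * cnj b = 1" "c * cnj c = 1"
    using circ circle_cnj by blast+
  have ck: "cnj k * (cnj b - cnj c) = cnj gab - cnj gac" using arg_cong[OF k', of cnj] by simp
  have ck': "cnj k * (c - b) * (A * B * C) = b * c * (gab * a * b * C - gac * a * c * B)"
    using ck cab cac n by algebra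
  have ce: "cnj e = cnj gbc + cnj a * cnj k" using arg_cong[OF e(1), of cnj] by (simp add: algebra_simps)
  have "e * cnj e - k * cnj k = e * cnj gbc + cnj a * cnj k * gbc"
  proof -
    have "x * (y + a' * z) - w * z = x * y + a' * z * v" if "x - a * w = v" "a * a' = 1" for x y z w v a' :: complex
    proof -
      have "a' * z * v = a' * z * x - (a * a') * (w * z)"
        unfolding that(1)[symmetric] by (simp add: algebra_simps)
      then show ?thesis using that(2) by (simp add: algebra_simps)
    qed
    from this[OF e(1) n(1)] show ?thesis unfolding ce .
  qed
  then have 1: "(b - c) * a * (A * ((e * cnj e - k * cnj k) * (B * C)))
      = (b - c) * a * (A * (e * (gbc * (b * c)))) + gbc * (cnj k * (b - c) * (A * B * C))"
    using cbc n(1) by algebra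
  have 2: "e * (b - c) = b * gab - c * gac" using k' unfolding e_def by algebra
  have "(b - c) * a * ((e * cnj e - k * cnj k) * (A * B * C))
      = gbc * (a * b * c) * (A * (b * gab - c * gac) - (gab * b * C - gac * c * B))"
    using 1 2 ck' by algebra
  also have "\<dots> = (b - c) * a * (gab * gac * gbc * (a * b * c))"
    using ab ac by algebra
  finally show "(e * cnj e - k * cnj k) * (A * B * C) = gab * gac * gbc * (a * b * c)"
    using neq circle_nonzero[OF circ(1)] by simp
qed

lemma continuous_map_moebius_topology_iff:
  "continuous_map (top_of_set S) moebius_topology B \<longleftrightarrow>
    (\<exists>u \<sigma>. continuous_on S u \<and> continuous_on S \<sigma> \<and>
      (\<forall>x\<in>S. u x \<in> circle \<and> norm (\<sigma> x) < 1 \<and> B x = moebius (u x, \<sigma> x)))"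
proof
  let ?D = "circle \<times> ball 0 1"
  let ?i = "the_inv_into ?D moebius"
  have inv: "?i (moebius p) = p" if "p \<in> ?D" for p
    using the_inv_into_f_f[OF inj_on_moebius that] .
  {
    assume B: "continuous_map (top_of_set S) moebius_topology B"
    have "continuous_map moebius_topology euclidean (id \<circ> ?i)"
      unfolding moebius_topology_def by (intro continuous_map_pullback continuous_map_id)
    from continuous_map_compose[OF B this] have c: "continuous_on S (?i \<circ> B)" by simp
    have m: "B x \<in> Moebius" if "x \<in> S" for x
      using continuous_map_image_subset_topspace[OF B] that
      by (auto simp: moebius_topology_def topspace_pullback_topology)
    show "\<exists>u \<sigma>. continuous_on S u \<and> continuous_on S \<sigma> \<and>
      (\<forall>x\<in>S. u x \<in> circle \<and> norm (\<sigma> x) < 1 \<and> B x = moebius (u x, \<sigma> x))"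
    proof (intro exI conjI ballI)
      show "continuous_on S (\<lambda>x. fst (?i (B x)))" "continuous_on S (\<lambda>x. snd (?i (B x)))"
        using c by (auto intro!: continuous_intros simp: o_def)
      fix x assume "x \<in> S"
      then obtain p where p: "p \<in> ?D" "B x = moebius p" using m unfolding Moebius_def by blast
      then have "?i (B x) = p" using inv by simp
      then show "fst (?i (B x)) \<in> circle" "norm (snd (?i (B x))) < 1"
        "B x = moebius (fst (?i (B x)), snd (?i (B x)))"
        using p by auto
    qed
  }
  {
    assume "\<exists>u \<sigma>. continuous_on S u \<and> continuous_on S \<sigma> \<and>
      (\<forall>x\<in>S. u x \<in> circle \<and> norm (\<sigma> x) < 1 \<and> B x = moebius (u x, \<sigma> x))"
    then obtain u \<sigma> where c: "continuous_on S u" "continuous_on S \<sigma>"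
      and B: "\<And>x. x \<in> S \<Longrightarrow> (u x, \<sigma> x) \<in> ?D \<and> B x = moebius (u x, \<sigma> x)"
      by auto
    have "continuous_on S (\<lambda>x. (u x, \<sigma> x))" by (intro continuous_intros c)
    then have "continuous_on S (?i \<circ> B)"
      by (rule continuous_on_eq) (use B inv in auto)
    moreover have "B x \<in> Moebius" if "x \<in> S" for x
      using B[OF that] by (auto simp: Moebius_def)
    ultimately show "continuous_map (top_of_set S) moebius_topology B"
      unfolding moebius_topology_def by (intro continuous_map_pullback') auto
  }
qed

text \<open>
  What the construction of the cocycle needs to know about a diffeomorphism. The sixth property says
  that the right-hand side of the last equation of \<open>moebius_interpolation_algebra\<close> is, after
  division by the product of the three values, a positive number.
\<close>

lemma slope_and_second_slope:
  assumes "C2_lift f F F' F''"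
  obtains g k where "continuous_on (circle \<times> circle) (\<lambda>(z, w). g z w)" "continuous_on circle3 k"
    "\<And>z w. g z w * (z - w) = f z - f w"
    "\<And>a b c. (a, b, c) \<in> distinct3 \<Longrightarrow> k (a, b, c) * (a - b) = g a c - g b c"
    "\<And>z w. \<lbrakk>z \<in> circle; w \<in> circle\<rbrakk> \<Longrightarrow> g z w \<noteq> 0"
    "\<And>a b c. \<lbrakk>a \<in> circle; b \<in> circle; c \<in> circle\<rbrakk> \<Longrightarrow>
      g a b * g a c * g b c * (a * b * c) = of_real (norm (g a b * g a c * g b c)) * (f a * f b * f c)"
    "\<And>t. g (cis t) (cis t) * cis t = of_real (F' t) * f (cis t)"
    "\<And>t. 2 * k (cis t, cis t, cis t) * cis t ^ 2
      = (of_real (F' t) ^ 2 - of_real (F' t) - \<i> * of_real (F'' t)) * f (cis t)"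
proof -
  interpret C2_on_circle f "\<lambda>t. cis (F t)" "\<lambda>t. \<i> * of_real (F' t) * cis (F t)"
    "\<lambda>t. (\<i> * of_real (F'' t) - of_real (F' t) ^ 2) * cis (F t)"
    by (rule C2_lift_imp_C2_on_circle[OF assms])
  obtain k where k: "continuous_on circle3 k"
    "\<And>a b c. (a, b, c) \<in> distinct3 \<Longrightarrow> k (a, b, c) * (a - b) = circle_slope f a c - circle_slope f b c"
    and kd: "\<And>t. k (cis t, cis t, cis t) = (\<i> * (\<i> * of_real (F' t) * cis (F t))
      - (\<i> * of_real (F'' t) - of_real (F' t) ^ 2) * cis (F t)) / (2 * cis t ^ 2)"
    using second_slope_exists by blast
  have polar: "\<exists>S>0. circle_slope f z w = of_real S * cis ((F (Arg z) + F (Arg w)) / 2 - (Arg z + Arg w) / 2)"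
    if "z \<in> circle" "w \<in> circle" for z w
  proof -
    have "\<bar>Arg z - Arg w\<bar> < 2 * pi" using Arg_bounded[of z] Arg_bounded[of w] by linarith
    from circle_slope_polar[OF assms this] show ?thesis
      using circle_cis_Arg[OF that(1)] circle_cis_Arg[OF that(2)] by simp
  qed
  show ?thesis
  proof (rule that[of "circle_slope f" k])
    show "circle_slope f z w \<noteq> 0" if "z \<in> circle" "w \<in> circle" for z w
      using polar[OF that] by auto
    show "circle_slope f a b * circle_slope f a c * circle_slope f b c * (a * b * c)
        = of_real (norm (circle_slope f a b * circle_slope f a c * circle_slope f b c)) * (f a * f b * f c)"
      if abc: "a \<in> circle" "b \<in> circle" "c \<in> circle" for a b c
    proof -
      obtain S1 S2 S3 where S: "S1 > 0" "S2 > 0" "S3 > 0"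
        "circle_slope f a b = of_real S1 * cis ((F (Arg a) + F (Arg b)) / 2 - (Arg a + Arg b) / 2)"
        "circle_slope f a c = of_real S2 * cis ((F (Arg a) + F (Arg c)) / 2 - (Arg a + Arg c) / 2)"
        "circle_slope f b c = of_real S3 * cis ((F (Arg b) + F (Arg c)) / 2 - (Arg b + Arg c) / 2)"
        using polar[OF abc(1,2)] polar[OF abc(1,3)] polar[OF abc(2,3)] by auto
      have "circle_slope f a b * circle_slope f a c * circle_slope f b c
          = of_real (S1 * S2 * S3) * (cis ((F (Arg a) + F (Arg b)) / 2 - (Arg a + Arg b) / 2)
            * cis ((F (Arg a) + F (Arg c)) / 2 - (Arg a + Arg c) / 2)
            * cis ((F (Arg b) + F (Arg c)) / 2 - (Arg b + Arg c) / 2))"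
        unfolding S by simp
      also have "\<dots> = of_real (S1 * S2 * S3) * cis (F (Arg a) + F (Arg b) + F (Arg c) - (Arg a + Arg b + Arg c))"
        unfolding cis_mult by (rule arg_cong2[where f = "(*)"], simp, rule arg_cong[where f = cis]) (simp add: field_simps)
      finally have P: "circle_slope f a b * circle_slope f a c * circle_slope f b c
          = of_real (S1 * S2 * S3) * cis (F (Arg a) + F (Arg b) + F (Arg c) - (Arg a + Arg b + Arg c))" .
      have "cis (Arg a) * cis (Arg b) * cis (Arg c) = a * b * c"
        using abc circle_cis_Arg by simp
      then have T: "a * b * c = cis (Arg a + Arg b + Arg c)" by (simp only: cis_mult)
      have "f z = cis (F (Arg z))" if "z \<in> circle" for z
        using f_cis[of "Arg z"] circle_cis_Arg[OF that] by simp
      then have X: "f a * f b * f c = cis (F (Arg a) + F (Arg b) + F (Arg c))"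
        using abc by (simp add: cis_mult)
      have nrm: "norm (circle_slope f a b * circle_slope f a c * circle_slope f b c) = S1 * S2 * S3"
        unfolding P using S(1-3) by (simp add: norm_mult)
      show ?thesis unfolding nrm unfolding P T X by (simp add: mult.assoc cis_mult)
    qed
    show "circle_slope f (cis t) (cis t) * cis t = of_real (F' t) * f (cis t)" for t
      using circle_slope_cis[of t t] by (simp add: lift_slope_def W_mean_def cis_mean_def f_cis)
    show "2 * k (cis t, cis t, cis t) * cis t ^ 2
      = (of_real (F' t) ^ 2 - of_real (F' t) - \<i> * of_real (F'' t)) * f (cis t)" for t
    proof -
      have "2 * k (cis t, cis t, cis t) * cis t ^ 2 = \<i> * (\<i> * of_real (F' t) * cis (F t))
          - (\<i> * of_real (F'' t) - of_real (F' t) ^ 2) * cis (F t)"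
        unfolding kd by simp
      then show ?thesis unfolding f_cis by (simp add: algebra_simps)
    qed
  qed (use continuous_on_circle_slope circle_slope_mult k in auto)
qed

lemma C2_lift_continuous_on_circle:
  assumes "C2_lift f F F' F''" shows "continuous_on circle f"
proof -
  obtain g where g: "continuous_on (circle \<times> circle) (\<lambda>(z, w). g z w)" "\<And>z w. g z w * (z - w) = f z - f w"
    using slope_and_second_slope[OF assms] by metis
  have "continuous_on circle (\<lambda>z. f 1 + (\<lambda>(z, w). g z w) (z, 1) * (z - 1))"
    by (intro continuous_intros continuous_on_compose2[OF g(1)]) auto
  then show ?thesis by (rule continuous_on_eq) (simp add: g(2))
qed

text \<open>
  The formula for the interpolating map involves only slopes and second slopes, so it extends to all
  triples. The last two properties compare \<open>f\<close> with the map attached to a constant triple: they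
  agree there to second order.
\<close>

theorem enlarged_cocycle_moebius:
  assumes lift: "C2_lift f F F' F''"
  obtains u \<sigma> where "continuous_on circle3 u" "continuous_on circle3 \<sigma>"
    "\<And>x. x \<in> circle3 \<Longrightarrow> u x \<in> circle \<and> norm (\<sigma> x) < 1"
    "\<And>x. x \<in> circle3 \<Longrightarrow> enlarged_cocycle f x = moebius (u x, \<sigma> x)"
    "\<And>a b c z. \<lbrakk>(a, b, c) \<in> distinct3; z \<in> {a, b, c}\<rbrakk>
      \<Longrightarrow> moebius (u (a, b, c), \<sigma> (a, b, c)) z = f z"
    "\<And>t. 2 * of_real (F' t) * moebius_jet (\<sigma> (cis t, cis t, cis t)) (cis t)
      = of_real (F' t) ^ 2 - of_real (F' t) - \<i> * of_real (F'' t)"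
    "\<And>t. moebius (u (cis t, cis t, cis t), \<sigma> (cis t, cis t, cis t)) (cis t) = f (cis t)"
proof -
  obtain g k where contg: "continuous_on (circle \<times> circle) (\<lambda>(z, w). g z w)"
    and contk: "continuous_on circle3 k"
    and g: "\<And>z w. g z w * (z - w) = f z - f w"
    and k: "\<And>a b c. (a, b, c) \<in> distinct3 \<Longrightarrow> k (a, b, c) * (a - b) = g a c - g b c"
    and g0: "\<And>z w. \<lbrakk>z \<in> circle; w \<in> circle\<rbrakk> \<Longrightarrow> g z w \<noteq> 0"
    and pos: "\<And>a b c. \<lbrakk>a \<in> circle; b \<in> circle; c \<in> circle\<rbrakk> \<Longrightarrow>
      g a b * g a c * g b c * (a * b * c) = of_real (norm (g a b * g a c * g b c)) * (f a * f b * f c)"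
    and gd: "\<And>t. g (cis t) (cis t) * cis t = of_real (F' t) * f (cis t)"
    and kd: "\<And>t. 2 * k (cis t, cis t, cis t) * cis t ^ 2
      = (of_real (F' t) ^ 2 - of_real (F' t) - \<i> * of_real (F'' t)) * f (cis t)"
    by (rule slope_and_second_slope[OF lift], rule that)
  have F: "f (cis t) = cis (F t)" "0 < F' t" for t using lift by (auto simp: C2_lift_def)
  have fcirc: "f z \<in> circle" if "z \<in> circle" for z
    using F(1)[of "Arg z"] circle_cis_Arg[OF that] by simp
  have contf: "continuous_on circle f" by (rule C2_lift_continuous_on_circle[OF lift])
  have cg: "continuous_on circle3 (\<lambda>x. g (p x) (q x))"
    if "continuous_on circle3 p" "p \<in> circle3 \<rightarrow> circle" "continuous_on circle3 q" "q \<in> circle3 \<rightarrow> circle" for p q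
  proof -
    have "(\<lambda>x. (p x, q x)) ` circle3 \<subseteq> circle \<times> circle" using that(2,4) unfolding Pi_def by blast
    from continuous_on_compose2[OF contg continuous_on_Pair[OF that(1,3)] this] show ?thesis by simp
  qed
  have cf: "continuous_on circle3 (\<lambda>x. f (p x))"
    if "continuous_on circle3 p" "p \<in> circle3 \<rightarrow> circle" for p
    using continuous_on_compose2[OF contf that(1)] that(2) by auto
  have pr: "continuous_on circle3 fst" "fst \<in> circle3 \<rightarrow> circle"
    "continuous_on circle3 (\<lambda>x. fst (snd x))" "(\<lambda>x. fst (snd x)) \<in> circle3 \<rightarrow> circle"
    "continuous_on circle3 (\<lambda>x. snd (snd x))" "(\<lambda>x. snd (snd x)) \<in> circle3 \<rightarrow> circle"
    by (auto intro!: continuous_intros)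
  \<comment> \<open>The quotient \<open>k / e\<close> will be the conjugate of \<open>\<sigma>\<close>, and \<open>N\<close> is \<open>\<bar>e\<bar>\<^sup>2 - \<bar>k\<bar>\<^sup>2\<close>.\<close>
  define e where "e = (\<lambda>x. g (fst x) (snd (snd x)) + fst (snd x) * k x)"
  have conte: "continuous_on circle3 e"
    unfolding e_def by (intro continuous_intros contk cg pr)
  define N where "N = (\<lambda>x. norm (g (fst x) (fst (snd x)) * g (fst x) (snd (snd x)) * g (fst (snd x)) (snd (snd x))))"
  have contN: "continuous_on circle3 (\<lambda>x. complex_of_real (N x))"
    unfolding N_def by (intro continuous_intros cg pr)
  have alg: "e (a, b, c) - a * k (a, b, c) = g b c" "e (a, b, c) - b * k (a, b, c) = g a c"
    "e (a, b, c) - c * k (a, b, c) = g a b"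
    "cnj (g a b) * (f a * f b) = g a b * (a * b)" "cnj (g a c) * (f a * f c) = g a c * (a * c)"
    "cnj (g b c) * (f b * f c) = g b c * (b * c)"
    "(e (a, b, c) * cnj (e (a, b, c)) - k (a, b, c) * cnj (k (a, b, c))) * (f a * f b * f c)
      = g a b * g a c * g b c * (a * b * c)" if "(a, b, c) \<in> distinct3" for a b c
  proof -
    have abc: "a \<in> circle" "b \<in> circle" "c \<in> circle" "a \<noteq> b" "a \<noteq> c" "b \<noteq> c"
      using that by (auto simp: distinct3_def)
    note m = moebius_interpolation_algebra[OF abc(1-3) fcirc[OF abc(1)] fcirc[OF abc(2)] fcirc[OF abc(3)]
        abc(4-6) g g g k[OF that]]
    show "e (a, b, c) - a * k (a, b, c) = g b c" "e (a, b, c) - b * k (a, b, c) = g a c"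
      "e (a, b, c) - c * k (a, b, c) = g a b"
      "cnj (g a b) * (f a * f b) = g a b * (a * b)" "cnj (g a c) * (f a * f c) = g a c * (a * c)"
      "cnj (g b c) * (f b * f c) = g b c * (b * c)"
      "(e (a, b, c) * cnj (e (a, b, c)) - k (a, b, c) * cnj (k (a, b, c))) * (f a * f b * f c)
        = g a b * g a c * g b c * (a * b * c)"
      using m unfolding e_def fst_conv snd_conv by blast+
  qed
  have normeq: "e x * cnj (e x) - k x * cnj (k x) = of_real (N x)" if "x \<in> circle3" for x
  proof (rule continuous_on_circle3_eq[OF _ contN _ that])
    show "continuous_on circle3 (\<lambda>x. e x * cnj (e x) - k x * cnj (k x))"
      by (intro continuous_intros conte contk)
    fix x :: "complex \<times> complex \<times> complex" assume x: "x \<in> distinct3"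
    obtain a b c where abc: "x = (a, b, c)" by (cases x)
    have circ: "a \<in> circle" "b \<in> circle" "c \<in> circle" using x by (auto simp: abc distinct3_def)
    have "(e x * cnj (e x) - k x * cnj (k x)) * (f a * f b * f c) = of_real (N x) * (f a * f b * f c)"
      using alg(7)[OF x[unfolded abc]] pos[OF circ] by (simp add: abc N_def)
    moreover have "f a * f b * f c \<noteq> 0" using fcirc circ circle_nonzero by simp
    ultimately show "e x * cnj (e x) - k x * cnj (k x) = of_real (N x)" by simp
  qed
  have Npos: "N x > 0" if "x \<in> circle3" for x
    using that g0 unfolding N_def by (auto simp: mem_Times_iff)
  have ke: "norm (k x) < norm (e x)" if x: "x \<in> circle3" for x
  proof -
    have "complex_of_real ((norm (e x))\<^sup>2 - (norm (k x))\<^sup>2) = of_real (N x)"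
      using normeq[OF x] by (simp only: of_real_diff complex_norm_square)
    then have "(norm (e x))\<^sup>2 - (norm (k x))\<^sup>2 = N x" by (simp only: of_real_eq_iff)
    then have "(norm (k x))\<^sup>2 < (norm (e x))\<^sup>2" using Npos[OF x] by simp
    then show ?thesis by (simp add: power_less_imp_less_base)
  qed
  then have e0: "e x \<noteq> 0" if "x \<in> circle3" for x using that by fastforce
  define \<sigma> where "\<sigma> = (\<lambda>x. cnj (k x / e x))"
  \<comment> \<open>At each of three distinct points \<open>z\<close>, the map \<open>(z - \<sigma>) / (1 - cnj \<sigma> z)\<close> equals \<open>f z\<close> divided by this number.\<close>
  define u where "u = (\<lambda>x. cnj (e x) / e x * ((f (fst x) * f (fst (snd x)) * f (snd (snd x)))
      / (fst x * fst (snd x) * snd (snd x))))"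
  have contu: "continuous_on circle3 u"
    unfolding u_def using e0 by (intro continuous_intros conte cf pr) auto
  have conts: "continuous_on circle3 \<sigma>"
    unfolding \<sigma>_def using e0 by (intro continuous_intros conte contk) auto
  have us: "u x \<in> circle \<and> norm (\<sigma> x) < 1" if x: "x \<in> circle3" for x
  proof
    have "norm (f (fst x)) = 1" "norm (f (fst (snd x))) = 1" "norm (f (snd (snd x))) = 1"
      using x fcirc by (auto simp: mem_Times_iff)
    then show "u x \<in> circle" using x e0[OF x] by (auto simp: u_def norm_mult norm_divide)
    show "norm (\<sigma> x) < 1" using ke[OF x] e0[OF x] by (simp add: \<sigma>_def norm_divide)
  qed
  have interp: "moebius (u (a, b, c), \<sigma> (a, b, c)) z = f z"
    if x: "(a, b, c) \<in> distinct3" and z: "z \<in> {a, b, c}" for a b c z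
  proof -
    have circ: "a \<in> circle" "b \<in> circle" "c \<in> circle" "(a, b, c) \<in> circle3"
      using x by (auto simp: distinct3_def)
    have nz: "a \<noteq> 0" "b \<noteq> 0" "c \<noteq> 0" "f a \<noteq> 0" "f b \<noteq> 0" "f c \<noteq> 0"
      using circ fcirc circle_nonzero by blast+
    let ?e = "e (a, b, c)"
    have e: "?e \<noteq> 0" "cnj ?e \<noteq> 0" using e0[OF circ(4)] by auto
    \<comment> \<open>Here \<open>h\<close> is the slope between \<open>v\<close> and \<open>w\<close>, the two points other than \<open>z\<close>.\<close>
    have key: "u (a, b, c) * ((z - \<sigma> (a, b, c)) / (1 - cnj (\<sigma> (a, b, c)) * z)) = Z"
      if z: "z \<in> circle" and h: "?e - z * k (a, b, c) = h" "h \<noteq> 0" "cnj h * (V * W) = h * (v * w)"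
        and n: "V \<noteq> 0" "W \<noteq> 0" "v \<noteq> 0" "w \<noteq> 0"
        and p: "f a * f b * f c = Z * (V * W)" "a * b * c = z * (v * w)" for z h V W v w Z
    proof -
      have zz: "z * cnj z = 1" using circle_cnj z by blast
      have d: "1 - cnj (\<sigma> (a, b, c)) * z = h / ?e"
        using h(1) e by (simp add: \<sigma>_def field_simps)
      have "z - \<sigma> (a, b, c) = z * cnj (1 - cnj (\<sigma> (a, b, c)) * z)"
        using zz by (simp add: algebra_simps)
      then have m: "z - \<sigma> (a, b, c) = z * (cnj h / cnj ?e)" unfolding d by simp
      have ch: "cnj h = h * (v * w) / (V * W)" using h(3) n by (simp add: field_simps)
      have "z \<noteq> 0" using z by auto
      then show ?thesis
        unfolding d m ch u_def fst_conv snd_conv p using e h(2) n by (simp add: field_simps)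
    qed
    show ?thesis
      using z key[OF circ(1) alg(1)[OF x] g0[OF circ(2,3)] alg(6)[OF x] nz(5,6,2,3), of "f a"]
        key[OF circ(2) alg(2)[OF x] g0[OF circ(1,3)] alg(5)[OF x] nz(4,6,1,3), of "f b"]
        key[OF circ(3) alg(3)[OF x] g0[OF circ(1,2)] alg(4)[OF x] nz(4,5,1,2), of "f c"] circ
      by (auto simp: moebius_apply mult_ac)
  qed
  have dist: "projective_cocycle f x = moebius (u x, \<sigma> x)" if x: "x \<in> distinct3" for x
  proof -
    obtain a b c where abc: "x = (a, b, c)" by (cases x)
    have x3: "x \<in> circle3" using x distinct3_subset by blast
    show ?thesis unfolding abc projective_cocycle_def prod.case
    proof (rule the_equality)
      show "moebius (u (a, b, c), \<sigma> (a, b, c)) \<in> Moebius \<and> moebius (u (a, b, c), \<sigma> (a, b, c)) a = f a \<and>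
          moebius (u (a, b, c), \<sigma> (a, b, c)) b = f b \<and> moebius (u (a, b, c), \<sigma> (a, b, c)) c = f c"
        using us[OF x3] interp[OF x[unfolded abc]] unfolding Moebius_def abc by auto
      fix m assume m: "m \<in> Moebius \<and> m a = f a \<and> m b = f b \<and> m c = f c"
      then obtain v s where v: "v \<in> circle" "norm s < 1" "m = moebius (v, s)"
        by (auto simp: Moebius_def)
      show "m = moebius (u (a, b, c), \<sigma> (a, b, c))"
        unfolding v(3) using us[OF x3] interp[OF x[unfolded abc]] m v
        by (intro moebius_eq_of_three_points[OF _ _ x[unfolded abc]]) (auto simp: abc)
    qed
  qed
  have enl: "enlarged_cocycle f = (\<lambda>x\<in>circle3. moebius (u x, \<sigma> x))"
    unfolding enlarged_cocycle_def
  proof (rule the_equality)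
    let ?\<Phi> = "\<lambda>x\<in>circle3. moebius (u x, \<sigma> x)"
    have "continuous_map (top_of_set circle3) moebius_topology ?\<Phi>"
      unfolding continuous_map_moebius_topology_iff
      using contu conts us by (intro exI[of _ u] exI[of _ \<sigma>]) auto
    then show "?\<Phi> \<in> extensional circle3 \<and> continuous_map (top_of_set circle3) moebius_topology ?\<Phi> \<and>
        (\<forall>x\<in>distinct3. ?\<Phi> x = projective_cocycle f x)"
      using dist distinct3_subset by auto
    fix \<Psi> assume \<Psi>: "\<Psi> \<in> extensional circle3 \<and> continuous_map (top_of_set circle3) moebius_topology \<Psi> \<and>
        (\<forall>x\<in>distinct3. \<Psi> x = projective_cocycle f x)"
    then obtain v s where v: "continuous_on circle3 v" "continuous_on circle3 s"
      "\<And>x. x \<in> circle3 \<Longrightarrow> v x \<in> circle \<and> norm (s x) < 1 \<and> \<Psi> x = moebius (v x, s x)"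
      using continuous_map_moebius_topology_iff[of circle3 \<Psi>] by blast
    have "(v x, s x) = (u x, \<sigma> x)" if x: "x \<in> distinct3" for x
    proof (rule inj_onD[OF inj_on_moebius])
      have x3: "x \<in> circle3" using x distinct3_subset by blast
      show "moebius (v x, s x) = moebius (u x, \<sigma> x)" using dist[OF x] \<Psi> v(3)[OF x3] x by simp
      show "(v x, s x) \<in> circle \<times> ball 0 1" "(u x, \<sigma> x) \<in> circle \<times> ball 0 1"
        using v(3)[OF x3] us[OF x3] by auto
    qed
    then have eq: "v x = u x" "s x = \<sigma> x" if "x \<in> distinct3" for x using that by auto
    have "v x = u x" "s x = \<sigma> x" if "x \<in> circle3" for x
      using continuous_on_circle3_eq[OF v(1) contu eq(1) that]
        continuous_on_circle3_eq[OF v(2) conts eq(2) that] by auto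
    then show "\<Psi> = ?\<Phi>" using \<Psi> v(3) by (intro extensionalityI[of _ circle3]) auto
  qed
  show ?thesis
  proof (rule that[OF contu conts us])
    show "enlarged_cocycle f x = moebius (u x, \<sigma> x)" if "x \<in> circle3" for x
      using that by (simp only: enl restrict_apply if_True)
    show "moebius (u (a, b, c), \<sigma> (a, b, c)) z = f z"
      if "(a, b, c) \<in> distinct3" "z \<in> {a, b, c}" for a b c z
      using interp[OF that] .
    fix t
    define z where "z = cis t"
    define d where "d = (z, z, z)"
    have d3: "d \<in> circle3" by (simp add: d_def z_def)
    have z0: "z \<noteq> 0" "z \<in> circle" by (auto simp: z_def)
    have f0: "f z \<noteq> 0" using fcirc[OF z0(2)] circle_nonzero by blast
    have gz: "g z z * z = of_real (F' t) * f z" using gd z_def by simp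
    have ed: "e d = g z z + z * k d" by (simp add: e_def d_def)
    have s1: "1 - cnj (\<sigma> d) * z = g z z / e d"
      using e0[OF d3] ed by (simp add: \<sigma>_def field_simps)
    have "moebius_jet (\<sigma> d) z = (k d / e d) * z / (g z z / e d)"
      unfolding moebius_jet_def s1 by (simp add: \<sigma>_def)
    then have "moebius_jet (\<sigma> d) z * g z z = k d * z"
      using e0[OF d3] g0[OF z0(2) z0(2)] by simp
    moreover have "2 * k d * z ^ 2 = (of_real (F' t) ^ 2 - of_real (F' t) - \<i> * of_real (F'' t)) * f z"
      using kd z_def d_def by simp
    ultimately have "f z * (2 * of_real (F' t) * moebius_jet (\<sigma> d) z)
        = f z * (of_real (F' t) ^ 2 - of_real (F' t) - \<i> * of_real (F'' t))"
      using gz by algebra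
    then show "2 * of_real (F' t) * moebius_jet (\<sigma> (cis t, cis t, cis t)) (cis t)
      = of_real (F' t) ^ 2 - of_real (F' t) - \<i> * of_real (F'' t)"
      using f0 by (simp add: d_def z_def)
    have "continuous_on circle3 (\<lambda>x. u x * ((fst x - \<sigma> x) / (1 - cnj (\<sigma> x) * fst x)))"
      using one_minus_cnj_mult_nonzero us
      by (intro continuous_intros contu conts) (auto simp: mem_Times_iff)
    then have "u d * ((fst d - \<sigma> d) / (1 - cnj (\<sigma> d) * fst d)) = f (fst d)"
    proof (rule continuous_on_circle3_eq[OF _ cf[OF pr(1,2)] _ d3])
      fix x :: "complex \<times> complex \<times> complex" assume x: "x \<in> distinct3"
      obtain a b c where abc: "x = (a, b, c)" by (cases x)
      have "a \<in> circle" using x by (auto simp: abc distinct3_def)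
      then show "u x * ((fst x - \<sigma> x) / (1 - cnj (\<sigma> x) * fst x)) = f (fst x)"
        using interp[OF x[unfolded abc], of a] by (simp add: abc moebius_apply)
    qed
    then show "moebius (u (cis t, cis t, cis t), \<sigma> (cis t, cis t, cis t)) (cis t) = f (cis t)"
      using z0 by (simp add: d_def z_def moebius_apply)
  qed
qed

section \<open>From an invariant jet to a smooth invariant density\<close>

text \<open>
  The equation for \<open>N\<close> is the transformation law of the logarithmic derivative of an invariant
  density, while \<open>\<rho>\<close> is itself an invariant density. So \<open>N\<close> may be changed by a multiple of \<open>\<rho>\<close>
  without affecting its law, and the multiple is chosen so that the result has mean zero over a
  period and is the derivative of a periodic function \<open>h\<close>. The density \<open>e\<^sup>h\<close> is then multiplied by
  a constant under every \<open>F\<close>, and conservation of total mass makes the constant 1.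
\<close>

lemma conjugating_lift_of_affine_cocycle:
  fixes \<rho> N :: "real \<Rightarrow> real"
  assumes c\<rho>: "continuous_on UNIV \<rho>" and cN: "continuous_on UNIV N"
    and pos: "\<And>t. 0 < \<rho> t"
    and per: "\<And>t. \<rho> (t + 2 * pi) = \<rho> t" "\<And>t. N (t + 2 * pi) = N t"
  obtains \<Phi> \<Phi>' \<Phi>'' where
    "\<And>t. (\<Phi> has_real_derivative \<Phi>' t) (at t)" "\<And>t. (\<Phi>' has_real_derivative \<Phi>'' t) (at t)"
    "continuous_on UNIV \<Phi>''" "\<And>t. 0 < \<Phi>' t" "\<And>t. \<Phi> (t + 2 * pi) = \<Phi> t + 2 * pi"
    "\<And>f F F' F''. \<lbrakk>C2_lift f F F' F''; \<And>t. \<rho> t = F' t * \<rho> (F t);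
      \<And>t. N t = F'' t / F' t + F' t * N (F t)\<rbrakk> \<Longrightarrow> \<exists>\<kappa>. \<forall>t. \<Phi> (F t) = \<Phi> t + \<kappa>"
proof -
  have antiderivative: "\<exists>A. \<forall>t. (A has_real_derivative p t) (at t)" if "continuous_on UNIV p" for p
  proof -
    have "isCont p x" for x using that by (simp add: continuous_on_eq_continuous_at)
    then show ?thesis
      using einterval_antiderivative[of "-\<infinity>" "\<infinity>" p]
      by (auto simp: has_real_derivative_iff_has_vector_derivative)
  qed
  have shift: "((\<lambda>t. A (t + 2 * pi)) has_real_derivative p (t + 2 * pi)) (at t)"
    if "\<And>t. (A has_real_derivative p t) (at t)" for A p t
    using that[of "t + 2 * pi"] by (simp add: DERIV_shift)
  obtain R where R: "\<And>t. (R has_real_derivative \<rho> t) (at t)" using antiderivative[OF c\<rho>] by blast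
  obtain M where M: "\<And>t. (M has_real_derivative N t) (at t)" using antiderivative[OF cN] by blast
  have "R 0 < R (2 * pi)"
    by (rule DERIV_pos_imp_increasing[where f = R]) (use R pos in auto)
  define c where "c = (M (2 * pi) - M 0) / (R (2 * pi) - R 0)"
  define h where "h = (\<lambda>t. M t - c * R t)"
  define h' where "h' = (\<lambda>t. N t - c * \<rho> t)"
  have h: "(h has_real_derivative h' t) (at t)" for t
    unfolding h_def h'_def by (intro derivative_intros M R DERIV_cmult)
  have ch': "continuous_on UNIV h'" unfolding h'_def by (intro continuous_intros cN c\<rho>)
  have hper: "h (t + 2 * pi) = h t" for t
  proof -
    have "((\<lambda>t. h (t + 2 * pi) - h t) has_real_derivative (h' (t + 2 * pi) - h' t)) (at t)" for t
      by (intro derivative_intros shift h)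
    then have "\<forall>t. ((\<lambda>t. h (t + 2 * pi) - h t) has_real_derivative 0) (at t)"
      by (simp add: h'_def per)
    note const = DERIV_isconst_all[OF this, of t 0]
    have "c * (R (2 * pi) - R 0) = M (2 * pi) - M 0"
      using \<open>R 0 < R (2 * pi)\<close> by (simp add: c_def)
    then have "h (2 * pi) = h 0" by (simp add: h_def algebra_simps)
    then show ?thesis using const by simp
  qed
  define p where "p = (\<lambda>t. exp (h t))"
  have p: "(p has_real_derivative p t * h' t) (at t)" for t
    unfolding p_def by (auto intro!: derivative_eq_intros h)
  have cp: "continuous_on UNIV p"
    using p DERIV_isCont continuous_at_imp_continuous_on by blast
  obtain A where A: "\<And>t. (A has_real_derivative p t) (at t)" using antiderivative[OF cp] by blast
  define I where "I = A (2 * pi) - A 0"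
  have "A 0 < A (2 * pi)"
  proof (rule DERIV_pos_imp_increasing[where f = A])
    show "\<exists>y. (A has_real_derivative y) (at x) \<and> 0 < y" for x
      by (intro exI[of _ "p x"] conjI A) (simp add: p_def)
  qed simp
  then have I: "0 < I" by (simp add: I_def)
  have Aper: "A (t + 2 * pi) = A t + I" for t
  proof -
    have "((\<lambda>t. A (t + 2 * pi) - A t) has_real_derivative (p (t + 2 * pi) - p t)) (at t)" for t
      by (intro derivative_intros shift A)
    then have "\<forall>t. ((\<lambda>t. A (t + 2 * pi) - A t) has_real_derivative 0) (at t)"
      by (simp add: p_def hper)
    from DERIV_isconst_all[OF this, of t 0] show ?thesis by (simp add: I_def)
  qed
  define s where "s = 2 * pi / I"
  have s: "0 < s" "s * I = 2 * pi" using I by (simp_all add: s_def)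
  show ?thesis
  proof (rule that[of "\<lambda>t. s * A t" "\<lambda>t. s * p t" "\<lambda>t. s * (p t * h' t)"])
    show "((\<lambda>t. s * A t) has_real_derivative s * p t) (at t)" for t by (rule DERIV_cmult[OF A])
    show "((\<lambda>t. s * p t) has_real_derivative s * (p t * h' t)) (at t)" for t by (rule DERIV_cmult[OF p])
    show "continuous_on UNIV (\<lambda>t. s * (p t * h' t))" by (intro continuous_intros cp ch')
    show "0 < s * p t" for t using s by (simp add: p_def)
    show "s * A (t + 2 * pi) = s * A t + 2 * pi" for t using s by (simp add: Aper distrib_left)
    fix f F F' F''
    assume lift: "C2_lift f F F' F''" and \<rho>: "\<And>t. \<rho> t = F' t * \<rho> (F t)"
      and N: "\<And>t. N t = F'' t / F' t + F' t * N (F t)"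
    have F: "(F has_real_derivative F' t) (at t)" "(F' has_real_derivative F'' t) (at t)"
      "0 < F' t" "F (t + 2 * pi) = F t + 2 * pi" for t
      using lift by (auto simp: C2_lift_def)
    define K where "K = (\<lambda>t. h (F t) + ln (F' t) - h t)"
    have "(K has_real_derivative (h' (F t) * F' t + F'' t / F' t - h' t)) (at t)" for t
      unfolding K_def using F[of t]
      by (intro derivative_intros DERIV_chain2[OF h] h) (auto intro!: derivative_eq_intros simp: field_simps)
    moreover have "h' (F t) * F' t + F'' t / F' t - h' t = 0" for t
      using \<rho>[of t] N[of t] by (simp add: h'_def algebra_simps)
    ultimately have "\<forall>t. (K has_real_derivative 0) (at t)" by simp
    note K_const = DERIV_isconst_all[OF this]
    have K: "h (F t) + ln (F' t) = K 0 + h t" for t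
      using K_const[of t 0] unfolding K_def by linarith
    have pF: "p (F t) * F' t = exp (K 0) * p t" for t
      using arg_cong[OF K[of t], of exp] F(3)[of t] by (simp add: exp_add p_def)
    have "((\<lambda>t. A (F t) - exp (K 0) * A t) has_real_derivative (p (F t) * F' t - exp (K 0) * p t)) (at t)" for t
      by (intro derivative_intros DERIV_chain2[OF A] F A DERIV_cmult)
    then have "\<forall>t. ((\<lambda>t. A (F t) - exp (K 0) * A t) has_real_derivative 0) (at t)" by (simp add: pF)
    note const = DERIV_isconst_all[OF this]
    \<comment> \<open>The increment of \<open>A\<close> over a period, before and after applying \<open>F\<close>.\<close>
    have "I = exp (K 0) * I"
      using const[of "0 + 2 * pi" 0] unfolding F(4) Aper by (simp add: algebra_simps)
    then have "exp (K 0) = 1" using I by simp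
    then have "A (F t) = A t + (A (F 0) - A 0)" for t using const[of t 0] by simp
    then show "\<exists>\<kappa>. \<forall>t. s * A (F t) = s * A t + \<kappa>"
      by (intro exI[of _ "s * (A (F 0) - A 0)"]) (metis distrib_left)
  qed
qed

lemma C2_realI:
  assumes "\<And>t. (F has_real_derivative F' t) (at t)" "\<And>t. (F' has_real_derivative F'' t) (at t)"
    "continuous_on UNIV F''"
  shows "C2_real F"
  unfolding C2_real_def by (intro exI[of _ F'] exI[of _ F''] conjI allI assms)

text \<open>
  Bijectivity of \<open>\<Phi>\<close> on the line comes from monotonicity and the periodicity condition; the lift of
  the inverse map is the inverse function of \<open>\<Phi>\<close>, whose derivatives are computed by the inverse function rule.
\<close>

lemma C2_diffeo_of_lift:
  assumes \<Phi>: "\<And>t. (\<Phi> has_real_derivative \<Phi>' t) (at t)" "\<And>t. (\<Phi>' has_real_derivative \<Phi>'' t) (at t)"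
    "continuous_on UNIV \<Phi>''" and pos: "\<And>t. 0 < \<Phi>' t"
    and per: "\<And>t. \<Phi> (t + 2 * pi) = \<Phi> t + 2 * pi"
  obtains \<phi> where "\<phi> \<in> C2_diffeos" "\<And>t. \<phi> (cis t) = cis (\<Phi> t)"
proof -
  define \<phi> where "\<phi> = (\<lambda>z\<in>circle. cis (\<Phi> (Arg z)))"
  interpret periodic_fun_simple "\<lambda>t. cis (\<Phi> t)" "2 * pi"
    by standard (simp add: per flip: cis_mult)
  have \<phi>: "\<phi> (cis t) = cis (\<Phi> t)" for t
  proof -
    have "cis (Arg (cis t)) = cis t" by (rule circle_cis_Arg) simp
    then have "sin (Arg (cis t)) = sin t \<and> cos (Arg (cis t)) = cos t" by (simp add: complex_eq_iff)
    then obtain n :: int where "Arg (cis t) = t + 2 * pi * n" using sin_cos_eq_iff by blast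
    then have "cis (\<Phi> (Arg (cis t))) = cis (\<Phi> t)"
      using plus_of_int[of t n] by (simp add: mult.commute)
    then show ?thesis by (simp add: \<phi>_def)
  qed
  have c\<Phi>: "continuous_on UNIV \<Phi>" "continuous_on UNIV \<Phi>'"
    using \<Phi>(1,2) DERIV_isCont continuous_at_imp_continuous_on by blast+
  have mono: "strict_mono \<Phi>"
    by (rule strict_monoI, rule DERIV_pos_imp_increasing) (use \<Phi>(1) pos in auto)
  have multiple: "\<Phi> (t + 2 * pi * n) = \<Phi> t + 2 * pi * n" for t and n :: nat
  proof (induction n)
    case (Suc n)
    then show ?case using per[of "t + 2 * pi * n"] by (simp add: algebra_simps)
  qed simp
  have surj: "\<exists>t. \<Phi> t = y" for y
  proof -
    obtain n :: nat where "\<bar>y - \<Phi> 0\<bar> / (2 * pi) \<le> n" using real_arch_simple by blast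
    then have n: "\<bar>y - \<Phi> 0\<bar> \<le> 2 * pi * n" by (simp add: field_simps)
    then have "\<Phi> (- (2 * pi * n)) \<le> y" "y \<le> \<Phi> (2 * pi * n)"
      using multiple[of "- (2 * pi * n)" n] multiple[of 0 n] by auto
    moreover have "- (2 * pi * real n) \<le> 2 * pi * n" by simp
    ultimately show ?thesis
      using IVT'[of \<Phi> "- (2 * pi * n)" y "2 * pi * n"] continuous_on_subset[OF c\<Phi>(1)] by auto
  qed
  define \<Psi> where "\<Psi> = inv_into UNIV \<Phi>"
  have \<Phi>\<Psi>: "\<Phi> (\<Psi> y) = y" for y using surj surj_f_inv_f[of \<Phi>] unfolding \<Psi>_def by (metis surjI)
  have \<Psi>\<Phi>: "\<Psi> (\<Phi> t) = t" for t
    using inv_f_f[OF strict_mono_imp_inj_on[OF mono]] by (simp add: \<Psi>_def)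
  have "isCont \<Psi> (\<Phi> t)" for t
    by (rule isCont_inverse_function[of 1 t \<Psi> \<Phi>]) (use \<Psi>\<Phi> DERIV_isCont[OF \<Phi>(1)] in auto)
  then have isC: "isCont \<Psi> y" for y by (metis \<Phi>\<Psi>)
  then have c\<Psi>: "continuous_on UNIV \<Psi>" by (simp add: continuous_on_eq_continuous_at)
  have \<Psi>: "(\<Psi> has_real_derivative inverse (\<Phi>' (\<Psi> y))) (at y)" for y
    by (rule DERIV_inverse_function[where f = \<Phi> and a = "y - 1" and b = "y + 1"])
      (use \<Phi>(1) pos \<Phi>\<Psi> isC in \<open>auto simp: less_imp_neq[symmetric]\<close>)
  have \<Psi>': "((\<lambda>y. inverse (\<Phi>' (\<Psi> y))) has_real_derivative
      - (\<Phi>'' (\<Psi> y) * inverse (\<Phi>' (\<Psi> y)) / (\<Phi>' (\<Psi> y))\<^sup>2)) (at y)" for y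
    using DERIV_inverse_fun[OF DERIV_chain2[OF \<Phi>(2) \<Psi>], of y] pos[of "\<Psi> y"]
    by (simp add: power2_eq_square field_simps)
  have "continuous_on UNIV (\<lambda>y. - (\<Phi>'' (\<Psi> y) * inverse (\<Phi>' (\<Psi> y)) / (\<Phi>' (\<Psi> y))\<^sup>2))"
    using pos by (intro continuous_intros continuous_on_compose2[OF \<Phi>(3)] continuous_on_compose2[OF c\<Phi>(2)] c\<Psi>)
      (auto simp: less_imp_neq[symmetric])
  note C2\<Psi> = C2_realI[OF \<Psi> \<Psi>' this]
  note C2\<Phi> = C2_realI[OF \<Phi>]
  have inj: "inj_on \<phi> circle"
  proof (rule inj_onI)
    fix z w assume zw: "z \<in> circle" "w \<in> circle" "\<phi> z = \<phi> w"
    let ?s = "Arg z" and ?t = "Arg w"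
    have "cis (\<Phi> ?s) = cis (\<Phi> ?t)" using zw by (simp add: \<phi>_def)
    moreover have "\<bar>\<Phi> ?s - \<Phi> ?t\<bar> < 2 * pi"
    proof -
      have "\<Phi> ?s < \<Phi> (?t + 2 * pi)" "\<Phi> ?t < \<Phi> (?s + 2 * pi)"
        using mono Arg_bounded[of z] Arg_bounded[of w] unfolding strict_mono_def by auto
      then show ?thesis by (simp add: per abs_less_iff)
    qed
    ultimately have "\<Phi> ?s = \<Phi> ?t" by (rule cis_eq_imp_eq)
    then have "?s = ?t" by (metis \<Psi>\<Phi>)
    then show "z = w" using zw circle_cis_Arg by metis
  qed
  have image: "\<phi> ` circle = circle"
  proof
    show "\<phi> ` circle \<subseteq> circle" by (auto simp: \<phi>_def)
    show "circle \<subseteq> \<phi> ` circle"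
    proof
      fix w :: complex assume "w \<in> circle"
      then have "w = \<phi> (cis (\<Psi> (Arg w)))" using circle_cis_Arg by (simp add: \<phi> \<Phi>\<Psi>)
      then show "w \<in> \<phi> ` circle" by (rule image_eqI) simp
    qed
  qed
  have "\<phi> \<in> C2_diffeos"
    unfolding C2_diffeos_def
  proof (intro CollectI conjI)
    show "\<phi> \<in> Bij circle" using inj image by (auto simp: Bij_def bij_betw_def \<phi>_def extensional_def)
    show "orientation_preserving \<phi>"
      unfolding orientation_preserving_def lifts_def using c\<Phi>(1) mono \<phi> by blast
    show "C2_circle_map \<phi>" unfolding C2_circle_map_def lifts_def using C2\<Phi> \<phi> by blast
    have "inv_into circle \<phi> (cis y) = cis (\<Psi> y)" for y
      using inv_into_f_f[OF inj, of "cis (\<Psi> y)"] by (simp add: \<phi> \<Phi>\<Psi>)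
    then show "C2_circle_map (inv_into circle \<phi>)"
      unfolding C2_circle_map_def lifts_def using C2\<Psi> by blast
  qed
  then show ?thesis using \<phi> that by blast
qed

section \<open>Reducibility and conjugacy\<close>

lemma continuous_on_moebius:
  assumes "continuous_on S u" "continuous_on S \<sigma>" "continuous_on S \<zeta>"
    and "\<And>x. x \<in> S \<Longrightarrow> norm (\<sigma> x) < 1 \<and> \<zeta> x \<in> circle"
  shows "continuous_on S (\<lambda>x. moebius (u x, \<sigma> x) (\<zeta> x))"
proof -
  have "continuous_on S (\<lambda>x. u x * ((\<zeta> x - \<sigma> x) / (1 - cnj (\<sigma> x) * \<zeta> x)))"
    using one_minus_cnj_mult_nonzero assms(4) by (intro continuous_intros assms(1-3)) auto
  then show ?thesis
    by (rule continuous_on_eq) (use assms(4) in \<open>simp add: moebius_apply\<close>)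
qed

lemma C2_diffeos_Bij: "f \<in> C2_diffeos \<Longrightarrow> f \<in> Bij circle"
  by (simp add: C2_diffeos_def)

lemma diagonal_action_mem:
  assumes "f \<in> Bij circle"
  shows "x \<in> circle3 \<Longrightarrow> diagonal_action f x \<in> circle3"
    and "x \<in> distinct3 \<Longrightarrow> diagonal_action f x \<in> distinct3"
proof -
  have "f z \<in> circle" if "z \<in> circle" for z using Bij_imp_funcset[OF assms] that by blast
  moreover have "f z \<noteq> f w" if "z \<in> circle" "w \<in> circle" "z \<noteq> w" for z w
    using assms that by (auto simp: Bij_def bij_betw_def dest: inj_onD)
  ultimately show "x \<in> circle3 \<Longrightarrow> diagonal_action f x \<in> circle3"
    and "x \<in> distinct3 \<Longrightarrow> diagonal_action f x \<in> distinct3"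
    by (auto simp: diagonal_action_def distinct3_def simp del: mem_sphere_0)
qed

text \<open>
  The cocycle of \<open>\<phi>\<close> itself is the reducing map. For distinct points both sides are Moebius maps
  with the same three values; for a fixed argument \<open>z\<close> both sides are continuous in the triple.
\<close>

lemma SO2_reducible_if_conjugate_to_rotations:
  assumes \<Gamma>: "\<Gamma> \<subseteq> C2_diffeos" and \<phi>: "\<phi> \<in> C2_diffeos"
    and conj: "\<And>f. f \<in> \<Gamma> \<Longrightarrow> \<exists>v\<in>circle. \<forall>z\<in>circle. \<phi> (f z) = v * \<phi> z"
  shows "SO2_reducible \<Gamma>"
proof -
  obtain P P' P'' where P: "C2_lift \<phi> P P' P''" using C2_diffeo_lift[OF \<phi>] by blast
  obtain u s where cu: "continuous_on circle3 u" and cs: "continuous_on circle3 s"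
    and us: "\<And>x. x \<in> circle3 \<Longrightarrow> u x \<in> circle \<and> norm (s x) < 1"
    and \<phi>int: "\<And>a b c z. \<lbrakk>(a, b, c) \<in> distinct3; z \<in> {a, b, c}\<rbrakk>
      \<Longrightarrow> moebius (u (a, b, c), s (a, b, c)) z = \<phi> z"
    by (rule enlarged_cocycle_moebius[OF P], rule that)
  define B where "B = (\<lambda>x. moebius (u x, s x))"
  have "continuous_map (top_of_set circle3) moebius_topology B"
    unfolding continuous_map_moebius_topology_iff B_def using cu cs us by blast
  moreover have "B (diagonal_action f x) \<otimes>\<^bsub>BijGroup circle\<^esub> enlarged_cocycle f x
      \<otimes>\<^bsub>BijGroup circle\<^esub> inv\<^bsub>BijGroup circle\<^esub> B x \<in> Rotations"
    if x: "x \<in> circle3" and f: "f \<in> \<Gamma>" for x f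
  proof -
    have fB: "f \<in> Bij circle" using f \<Gamma> C2_diffeos_Bij by blast
    obtain F F' F'' where lift: "C2_lift f F F' F''" using C2_diffeo_lift f \<Gamma> by blast
    obtain w r where cw: "continuous_on circle3 w" and cr: "continuous_on circle3 r"
      and wr: "\<And>x. x \<in> circle3 \<Longrightarrow> w x \<in> circle \<and> norm (r x) < 1"
      and feq: "\<And>x. x \<in> circle3 \<Longrightarrow> enlarged_cocycle f x = moebius (w x, r x)"
      and fint: "\<And>a b c z. \<lbrakk>(a, b, c) \<in> distinct3; z \<in> {a, b, c}\<rbrakk>
        \<Longrightarrow> moebius (w (a, b, c), r (a, b, c)) z = f z"
      by (rule enlarged_cocycle_moebius[OF lift], rule that)
    obtain v where v: "v \<in> circle" "\<And>z. z \<in> circle \<Longrightarrow> \<phi> (f z) = v * \<phi> z" using conj[OF f] by blast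
    have cd: "continuous_on circle3 (diagonal_action f)"
      unfolding diagonal_action_def case_prod_unfold
      by (intro continuous_intros continuous_on_compose2[OF C2_lift_continuous_on_circle[OF lift]]) auto
    have dm: "diagonal_action f x \<in> circle3" if "x \<in> circle3" for x
      using diagonal_action_mem(1)[OF fB that] .
    let ?d = "diagonal_action f"
    have "moebius (u (?d x), s (?d x)) (moebius (w x, r x) z) = v * moebius (u x, s x) z"
      if z: "z \<in> circle" for z
    proof (rule continuous_on_circle3_eq[OF _ _ _ x])
      have m: "moebius (w x, r x) z \<in> circle" if "x \<in> circle3" for x
        using moebius_in_circle wr[OF that] z by blast
      show "continuous_on circle3 (\<lambda>x. moebius (u (?d x), s (?d x)) (moebius (w x, r x) z))"
      proof (rule continuous_on_moebius)
        have di: "?d ` circle3 \<subseteq> circle3" using dm by (rule image_subsetI)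
        show "continuous_on circle3 (\<lambda>x. u (?d x))" "continuous_on circle3 (\<lambda>x. s (?d x))"
          by (rule continuous_on_compose2[OF _ cd di], fact)+
        show "continuous_on circle3 (\<lambda>x. moebius (w x, r x) z)"
          using wr z by (intro continuous_on_moebius cw cr continuous_on_const conjI) blast+
        show "norm (s (?d x)) < 1 \<and> moebius (w x, r x) z \<in> circle" if "x \<in> circle3" for x
          using us[OF dm[OF that]] m[OF that] by blast
      qed
      show "continuous_on circle3 (\<lambda>x. v * moebius (u x, s x) z)"
        using us z by (intro continuous_on_mult continuous_on_moebius cu cs continuous_on_const) auto
      fix x :: "complex \<times> complex \<times> complex" assume x: "x \<in> distinct3"
      obtain a b c where abc: "x = (a, b, c)" by (cases x)
      have x3: "x \<in> circle3" using x distinct3_subset by blast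
      have circ: "y \<in> circle" if "y \<in> {a, b, c}" for y using x3 that by (auto simp: abc)
      obtain q e where q: "norm e < 1"
        "\<And>z. z \<in> circle \<Longrightarrow> moebius (u (?d x), s (?d x)) (moebius (w x, r x) z) = moebius (q, e) z"
        using moebius_compose(2,4)[of "w x" "r x" "u (?d x)" "s (?d x)"] wr[OF x3] us[OF dm[OF x3]] by blast
      have rot: "moebius (v * u x, s x) z = v * moebius (u x, s x) z" if "z \<in> circle" for z
        using that by (simp add: moebius_apply)
      have "moebius (q, e) = moebius (v * u x, s x)"
      proof (rule moebius_eq_of_three_points[OF q(1) _ x[unfolded abc]])
        show "norm (s x) < 1" using us[OF x3] by blast
        fix y assume y: "y \<in> {a, b, c}"
        have "moebius (q, e) y = moebius (u (?d x), s (?d x)) (f y)"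
          using q(2)[OF circ[OF y]] fint[OF x[unfolded abc] y] by (simp add: abc)
        also have "\<dots> = \<phi> (f y)"
          using \<phi>int[of "f a" "f b" "f c" "f y"] y diagonal_action_mem(2)[OF fB x]
          by (auto simp: abc diagonal_action_def)
        also have "\<dots> = moebius (v * u x, s x) y"
          using v(2)[OF circ[OF y]] \<phi>int[OF x[unfolded abc] y] rot[OF circ[OF y]] by (simp add: abc)
        finally show "moebius (q, e) y = moebius (v * u x, s x) y" .
      qed
      then show "moebius (u (?d x), s (?d x)) (moebius (w x, r x) z) = v * moebius (u x, s x) z"
        using q(2)[OF z] rot[OF z] by simp
    qed
    then show ?thesis
      unfolding feq[OF x] B_def
      using conjugate_in_Rotations_iff[OF moebius_Bij moebius_Bij moebius_Bij]
        us[OF x] us[OF dm[OF x]] wr[OF x] v(1) by blast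
  qed
  ultimately show ?thesis unfolding SO2_reducible_def by blast
qed

text \<open>
  On constant triples the cocycle is the 2-jet of \<open>f\<close>, so that reducibility there becomes the pair of equations of \<open>conjugating_lift_of_affine_cocycle\<close> for the real and imaginary
  parts of the jet of the reducing map.
\<close>

lemma conjugate_to_rotations_if_SO2_reducible:
  assumes \<Gamma>: "\<Gamma> \<subseteq> C2_diffeos" and red: "SO2_reducible \<Gamma>"
  shows "\<exists>\<phi>\<in>C2_diffeos. \<forall>f\<in>\<Gamma>. \<exists>v\<in>circle. \<forall>z\<in>circle. \<phi> (f z) = v * \<phi> z"
proof -
  obtain B where B: "continuous_map (top_of_set circle3) moebius_topology B"
    and red: "\<And>x f. \<lbrakk>x \<in> circle3; f \<in> \<Gamma>\<rbrakk> \<Longrightarrow> B (diagonal_action f x) \<otimes>\<^bsub>BijGroup circle\<^esub> enlarged_cocycle f x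
            \<otimes>\<^bsub>BijGroup circle\<^esub> inv\<^bsub>BijGroup circle\<^esub> B x \<in> Rotations"
    using red unfolding SO2_reducible_def by blast
  obtain u \<tau> where cu: "continuous_on circle3 u" and c\<tau>: "continuous_on circle3 \<tau>"
    and u\<tau>: "\<And>x. x \<in> circle3 \<Longrightarrow> u x \<in> circle \<and> norm (\<tau> x) < 1"
    and Beq: "\<And>x. x \<in> circle3 \<Longrightarrow> B x = moebius (u x, \<tau> x)"
    using B unfolding continuous_map_moebius_topology_iff by blast
  define d where "d = (\<lambda>t::real. (cis t, cis t, cis t))"
  have d: "d t \<in> circle3" for t by (simp add: d_def)
  have circ: "cis t \<in> circle" for t by simp
  define c where "c = (\<lambda>t. moebius_jet (\<tau> (d t)) (cis t))"
  have "continuous_on UNIV (\<lambda>t. \<tau> (d t))"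
    by (rule continuous_on_compose2[OF c\<tau>]) (auto simp: d_def intro!: continuous_intros)
  then have cont_c: "continuous_on UNIV c"
    unfolding c_def moebius_jet_def
    using one_minus_cnj_mult_nonzero u\<tau>[OF d] by (intro continuous_intros) auto
  have "cis (t + 2 * pi) = cis t" for t by (simp flip: cis_mult)
  then have per: "c (t + 2 * pi) = c t" for t by (simp add: c_def d_def)
  define \<rho> where "\<rho> = (\<lambda>t. 1 + 2 * Re (c t))"
  define N where "N = (\<lambda>t. - 2 * Im (c t))"
  have "continuous_on UNIV \<rho>" "continuous_on UNIV N"
    unfolding \<rho>_def N_def by (intro continuous_intros cont_c)+
  moreover have "0 < \<rho> t" for t
    unfolding \<rho>_def c_def using one_plus_Re_moebius_jet_pos u\<tau>[OF d] circ by blast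
  moreover have "\<rho> (t + 2 * pi) = \<rho> t" "N (t + 2 * pi) = N t" for t
    by (simp_all add: \<rho>_def N_def per)
  ultimately obtain \<Phi> \<Phi>' \<Phi>'' where \<Phi>: "\<And>t. (\<Phi> has_real_derivative \<Phi>' t) (at t)"
    "\<And>t. (\<Phi>' has_real_derivative \<Phi>'' t) (at t)"
    "continuous_on UNIV \<Phi>''" "\<And>t. 0 < \<Phi>' t" "\<And>t. \<Phi> (t + 2 * pi) = \<Phi> t + 2 * pi"
    and conj: "\<And>f F F' F''. \<lbrakk>C2_lift f F F' F''; \<And>t. \<rho> t = F' t * \<rho> (F t);
      \<And>t. N t = F'' t / F' t + F' t * N (F t)\<rbrakk> \<Longrightarrow> \<exists>\<kappa>. \<forall>t. \<Phi> (F t) = \<Phi> t + \<kappa>"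
    using conjugating_lift_of_affine_cocycle[of \<rho> N] by blast
  obtain \<phi> where \<phi>: "\<phi> \<in> C2_diffeos" "\<And>t. \<phi> (cis t) = cis (\<Phi> t)"
    using C2_diffeo_of_lift[OF \<Phi>] by blast
  have "\<exists>v\<in>circle. \<forall>z\<in>circle. \<phi> (f z) = v * \<phi> z" if f: "f \<in> \<Gamma>" for f
  proof -
    have fB: "f \<in> Bij circle" using f \<Gamma> C2_diffeos_Bij by blast
    obtain F F' F'' where lift: "C2_lift f F F' F''" using C2_diffeo_lift f \<Gamma> by blast
    then have F: "f (cis t) = cis (F t)" "0 < F' t" for t by (auto simp: C2_lift_def)
    obtain w \<sigma> where w\<sigma>: "\<And>x. x \<in> circle3 \<Longrightarrow> w x \<in> circle \<and> norm (\<sigma> x) < 1"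
      and feq: "\<And>x. x \<in> circle3 \<Longrightarrow> enlarged_cocycle f x = moebius (w x, \<sigma> x)"
      and jet: "\<And>t. 2 * of_real (F' t) * moebius_jet (\<sigma> (d t)) (cis t)
        = of_real (F' t) ^ 2 - of_real (F' t) - \<i> * of_real (F'' t)"
      and val: "\<And>t. moebius (w (d t), \<sigma> (d t)) (cis t) = f (cis t)"
      using enlarged_cocycle_moebius[OF lift] unfolding d_def by metis
    have eqs: "\<rho> t = F' t * \<rho> (F t) \<and> N t = F'' t / F' t + F' t * N (F t)" for t
    proof -
      have fd: "diagonal_action f (d t) = d (F t)" by (simp add: diagonal_action_def d_def F)
      define q where "q = moebius_jet (\<sigma> (d t)) (cis t)"
      obtain v where v: "v \<in> circle" "\<And>z. z \<in> circle \<Longrightarrow>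
          moebius (u (d (F t)), \<tau> (d (F t))) (moebius (w (d t), \<sigma> (d t)) z) = v * moebius (u (d t), \<tau> (d t)) z"
        using red[OF d[of t] f] unfolding fd Beq[OF d] feq[OF d]
        using conjugate_in_Rotations_iff[OF moebius_Bij moebius_Bij moebius_Bij] u\<tau>[OF d] w\<sigma>[OF d] by metis
      have vu: "v * u (d t) \<in> circle" using v(1) u\<tau>[OF d[of t]] by (simp add: norm_mult)
      have comp: "moebius (u (d (F t)), \<tau> (d (F t))) (moebius (w (d t), \<sigma> (d t)) z)
          = moebius (v * u (d t), \<tau> (d t)) z" if "z \<in> circle" for z
        using v(2)[OF that] that by (simp add: moebius_apply)
      have "c t = q + of_real (1 + 2 * Re q) * c (F t)"
        unfolding c_def q_def
        using moebius_jet_compose[of "w (d t)" "\<sigma> (d t)" "u (d (F t))" "\<tau> (d (F t))", OF _ _ _ _ vu _ comp circ[of t]]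
          w\<sigma>[OF d] u\<tau>[OF d] val[of t] F(1)[of t] by simp
      then have c: "Re (c t) = Re q + (1 + 2 * Re q) * Re (c (F t))"
        "Im (c t) = Im q + (1 + 2 * Re q) * Im (c (F t))" by simp_all
      have "2 * of_real (F' t) * q = of_real (F' t) ^ 2 - of_real (F' t) - \<i> * of_real (F'' t)"
        using jet[of t] by (simp add: q_def)
      then have "Re (2 * of_real (F' t) * q) = Re (of_real (F' t) ^ 2 - of_real (F' t) - \<i> * of_real (F'' t))"
        "Im (2 * of_real (F' t) * q) = Im (of_real (F' t) ^ 2 - of_real (F' t) - \<i> * of_real (F'' t))"
        by simp_all
      then have "2 * F' t * Re q = F' t ^ 2 - F' t" "2 * F' t * Im q = - F'' t"
        by (simp_all flip: of_real_power)
      then have "F' t * (1 + 2 * Re q) = F' t * F' t" and Im: "2 * Im q = - F'' t / F' t"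
        using F(2)[of t] by (simp_all add: algebra_simps power2_eq_square field_simps)
      then have Re: "1 + 2 * Re q = F' t" using F(2)[of t] by simp
      have "Re (c t) = Re q + F' t * Re (c (F t))" "Im (c t) = Im q + F' t * Im (c (F t))"
        using c unfolding Re by auto
      moreover have "F' t * \<rho> (F t) = F' t + 2 * (F' t * Re (c (F t)))"
        "F' t * N (F t) = - (2 * (F' t * Im (c (F t))))"
        by (simp_all add: \<rho>_def N_def distrib_left)
      ultimately show ?thesis
        using Re Im unfolding \<rho>_def N_def by auto
    qed
    then obtain \<kappa> where \<kappa>: "\<Phi> (F t) = \<Phi> t + \<kappa>" for t using conj[OF lift] by blast
    show ?thesis
    proof (intro bexI ballI)
      fix z assume "z \<in> circle"
      then have "z = cis (Arg z)" using circle_cis_Arg by simp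
      then show "\<phi> (f z) = cis \<kappa> * \<phi> z"
        by (metis F(1) \<phi>(2) \<kappa> cis_mult mult.commute)
    qed simp
  qed
  then show ?thesis using \<phi>(1) by blast
qed

theorem theoremA:
  fixes \<Gamma> :: "(complex \<Rightarrow> complex) set"
  assumes "subgroup \<Gamma> (BijGroup circle)"
    and "\<Gamma> \<subseteq> C2_diffeos"
  shows "SO2_reducible \<Gamma> \<longleftrightarrow>
    (\<exists>\<phi>\<in>C2_diffeos. \<forall>f\<in>\<Gamma>.
       \<phi> \<otimes>\<^bsub>BijGroup circle\<^esub> f \<otimes>\<^bsub>BijGroup circle\<^esub> inv\<^bsub>BijGroup circle\<^esub> \<phi> \<in> Rotations)"
proof -
  have "(\<phi> \<otimes>\<^bsub>BijGroup circle\<^esub> f \<otimes>\<^bsub>BijGroup circle\<^esub> inv\<^bsub>BijGroup circle\<^esub> \<phi> \<in> Rotations)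
      \<longleftrightarrow> (\<exists>v\<in>circle. \<forall>z\<in>circle. \<phi> (f z) = v * \<phi> z)"
    if "\<phi> \<in> C2_diffeos" "f \<in> \<Gamma>" for \<phi> f
    using conjugate_in_Rotations_iff assms(2) that C2_diffeos_Bij by blast
  then show ?thesis
    using SO2_reducible_if_conjugate_to_rotations[OF assms(2)]
      conjugate_to_rotations_if_SO2_reducible[OF assms(2)] by blast
qed

end
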